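(* Let $\mathcal{A}$ be an $S$-ring of rank $4$ over a finite cyclic group $G$. Then one of the following holds: (1) $\mathcal{A}=\mathcal{T}_L\otimes\mathcal{T}_U$ for nontrivial $\mathcal{A}$-subgroups $L,U$ with $G=L\times U$ (i.e. the basic sets are $\{e\}$, $L^\#$, $U^\#$, $L^\#U^\#$); (2) $\mathcal{A}=(\mathcal{T}_L\wr\mathcal{T}_{U/L})\wr\mathcal{T}_{G/U}$ for nontrivial $\mathcal{A}$-subgroups $L<U$ (i.e. the basic sets are $\{e\}$, $L^\#$, $U\setminus L$, $G\setminus U$); (3) $\mathcal{A}=\mathrm{Cyc}(\frac{p-1}{2},L)\wr\mathcal{T}_{G/L}$ for a nontrivial $\mathcal{A}$-subgroup $L$ of prime order $p\ge 3$; (4) $\mathcal{A}=\mathcal{T}_L\wr\mathrm{Cyc}(\frac{p-1}{2},G/L)$ for a nontrivial $\mathcal{A}$-subgroup $L$ of prime index $p\ge 3$; (5) $|G|=p$ for a prime $p\equiv 1\pmod 3$ and $\mathcal{A}=\mathrm{Cyc}(\frac{p-1}{3},G)$; (6) $|G|=4$ and $\mathcal{A}=\mathbb{Z}G$.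
   Context: Let $G$ be a finite group with identity $e$, $H^\#=H\setminus\{e\}$, and for $X\subseteq G$ let $\underline{X}=\sum_{x\in X}x\in\mathbb{Z}G$. An $S$-ring over $G$ is a subring $\mathcal{A}\subseteq\mathbb{Z}G$ for which there is a partition $\mathcal{S}(\mathcal{A})$ of $G$ (the basic sets) with $\{e\}\in\mathcal{S}(\mathcal{A})$, $X\in\mathcal{S}(\mathcal{A})\Rightarrow X^{-1}\in\mathcal{S}(\mathcal{A})$, and $\mathcal{A}=\mathrm{Span}_{\mathbb{Z}}\{\underline{X}:X\in\mathcal{S}(\mathcal{A})\}$; its rank is $|\mathcal{S}(\mathcal{A})|$. A subgroup $H$ is an $\mathcal{A}$-subgroup if $\underline{H}\in\mathcal{A}$; it is nontrivial if $\{e\}<H<G$. For $\mathcal{A}$-subgroups $L\trianglelefteq U$, $\mathcal{A}_{U/L}$ is the $S$-ring over $U/L$ spanned by the images of the basic sets contained in $U$ under $U\to U/L$, and $\mathcal{A}_U=\mathcal{A}_{U/\{e\}}$. $\mathcal{T}_H$ is the $S$-ring over $H$ with basic sets $\{e\},H^\#$; $\mathbb{Z}G$ is the $S$-ring with all basic sets singletons. For $K\le\mathrm{Aut}(H)$, $\mathrm{Cyc}(K,H)$ is the $S$-ring over $H$ whose basic sets are the $K$-orbits; if $|H|=p$ is prime and $k\mid p-1$, $\mathrm{Cyc}(k,H)=\mathrm{Cyc}(K,H)$ for the unique $K\le\mathrm{Aut}(H)$ of order $k$. If $G=H\times V$ with $H,V$ $\mathcal{A}$-subgroups, $\mathcal{A}=\mathcal{A}_H\otimes\mathcal{A}_V$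 means $\mathcal{S}(\mathcal{A})=\{X_1\times X_2:X_1\in\mathcal{S}(\mathcal{A}_H),X_2\in\mathcal{S}(\mathcal{A}_V)\}$. For a normal $\mathcal{A}$-subgroup $L$, $\mathcal{A}=\mathcal{A}_L\wr\mathcal{A}_{G/L}$ means $LX=XL=X$ for every basic set $X$ not contained in $L$. *)

theory Defs
  imports "HOL-Algebra.Algebra" "HOL-Library.Disjoint_Sets"
begin

definition fin_cyclic :: "('a, 'b) monoid_scheme \<Rightarrow> bool" where
  "fin_cyclic G \<longleftrightarrow> group G \<and> finite (carrier G) \<and>
     (\<exists>g\<in>carrier G. carrier G = generate G {g})"

text \<open>Elements of the group ring ZG are modelled as integer-valued functions
  supported on the carrier; multiplication is convolution.\<close>
definition gr_elem :: "('a, 'b) monoid_scheme \<Rightarrow> ('a \<Rightarrow> int) set" where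
  "gr_elem G = {f. \<forall>x. x \<notin> carrier G \<longrightarrow> f x = 0}"

definition conv :: "('a, 'b) monoid_scheme \<Rightarrow> ('a \<Rightarrow> int) \<Rightarrow> ('a \<Rightarrow> int) \<Rightarrow> 'a \<Rightarrow> int" where
  "conv G f g z = (if z \<in> carrier G
     then (\<Sum>x\<in>carrier G. f x * g (inv\<^bsub>G\<^esub> x \<otimes>\<^bsub>G\<^esub> z)) else 0)"

text \<open>Z-span of the elements \<open>\<underline>X\<close>, X in the partition S (G finite):
  exactly the elements of ZG that are constant on every block of S.\<close>
definition sspan :: "('a, 'b) monoid_scheme \<Rightarrow> 'a set set \<Rightarrow> ('a \<Rightarrow> int) set" where
  "sspan G S = {f \<in> gr_elem G. \<forall>B\<in>S. \<forall>x\<in>B. \<forall>y\<in>B. f x = f y}"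

text \<open>S is the set of basic sets of an S-ring over G (the S-ring being sspan G S).\<close>
definition is_sring :: "('a, 'b) monoid_scheme \<Rightarrow> 'a set set \<Rightarrow> bool" where
  "is_sring G S \<longleftrightarrow> partition_on (carrier G) S \<and> {\<one>\<^bsub>G\<^esub>} \<in> S \<and>
     (\<forall>B\<in>S. (\<lambda>x. inv\<^bsub>G\<^esub> x) ` B \<in> S) \<and>
     (\<forall>f\<in>sspan G S. \<forall>g\<in>sspan G S. conv G f g \<in> sspan G S)"

definition indic :: "'a set \<Rightarrow> 'a \<Rightarrow> int" where
  "indic B x = (if x \<in> B then 1 else 0)"

definition a_subgroup :: "('a, 'b) monoid_scheme \<Rightarrow> 'a set set \<Rightarrow> 'a set \<Rightarrow> bool" where
  "a_subgroup G S H \<longleftrightarrow> subgroup H G \<and> indic H \<in> sspan G S"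

definition nontriv_a_subgroup :: "('a, 'b) monoid_scheme \<Rightarrow> 'a set set \<Rightarrow> 'a set \<Rightarrow> bool" where
  "nontriv_a_subgroup G S H \<longleftrightarrow> a_subgroup G S H \<and> H \<noteq> {\<one>\<^bsub>G\<^esub>} \<and> H \<noteq> carrier G"

text \<open>P is the set of basic sets of Cyc(K, H) for some subgroup K of Aut(H) of order k
  (for |H| prime such K is unique).\<close>
definition is_Cyc :: "('a, 'b) monoid_scheme \<Rightarrow> nat \<Rightarrow> 'a set set \<Rightarrow> bool" where
  "is_Cyc H k P \<longleftrightarrow> (\<exists>K. subgroup K (AutoGroup H) \<and> card K = k \<and>
      P = {(\<lambda>\<sigma>. \<sigma> x) ` K | x. x \<in> carrier H})"

end

theory Submission
  imports "HOL-Computational_Algebra.Polynomial" Defs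
begin

text \<open>
  Call a union of basic sets an A-set. Computing \<open>p\<close>-th powers in the group ring modulo a prime \<open>p\<close>
  shows that for an A-set \<open>W\<close> the set of all \<open>y\<close> for which \<open>p\<close> does not divide the number of
  \<open>x \<in> W\<close> with \<open>x [^] p = y\<close> is again an A-set (Schur). For \<open>p\<close> prime to the order this gives that the
  automorphisms of \<open>G\<close> permute the basic sets; for \<open>p\<close> dividing the order it gives, by a counting
  argument, that a primitive S-ring of rank at least 3 lives on a group of prime order, where the
  basic sets are the orbits of a group of automorphisms.

  In rank 4 a nontrivial A-subgroup \<open>H\<close> contains two or three basic sets. In the second case
  \<open>G - H\<close> is basic and \<open>H\<close> carries an S-ring of rank 3. Otherwise \<open>H - {\<one>}\<close> is basic for every such
  \<open>H\<close>; two of them give the tensor product. If \<open>L\<close> is the only one, with \<open>G - L = W \<union> Y\<close>, then either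
  \<open>W\<close> and \<open>Y\<close> are unions of cosets and \<open>G / L\<close> carries a primitive S-ring of rank 3, or all cosets
  outside \<open>L\<close> are divided between \<open>W\<close> and \<open>Y\<close> in the same proportion. In this last case
  \<open>card L\<close> is a power of the prime \<open>p = card (G / L)\<close>, the multipliers interchange \<open>W\<close> and \<open>Y\<close>, and
  counting quotients once more leaves only the group of order 4.
\<close>

text \<open>The obstacle is a prime \<open>p\<close> dividing the order: taking \<open>p\<close>-th
  powers is then not injective, and a congruence modulo \<open>p\<close> no longer sees every point
  of \<open>W\<close>. What it misses is still informative. A fibre over which the congruence
  vanishes is either empty or a full coset of the group \<open>P\<close> of solutions of
  \<open>z [^] p = \<one>\<close>. The remaining fibres lie over an A-set \<open>E\<close> of
  \<open>p\<close>-th powers, hence inside a proper subgroup. Knowing all A-subgroups locates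
  \<open>E\<close>: it lies in \<open>{\<one>}\<close> if there is no nontrivial one, and in
  \<open>L\<close> if \<open>L\<close> is the only one. So, away from a torsion subgroup, a basic
  set is invariant under \<open>P\<close>, and a nonidentity element of \<open>P\<close> occurs very
  often as a quotient of two of its elements. The number of such occurrences is constant on basic
  sets, while the total number of quotients is fixed by cardinalities alone; these two facts clash
  unless the torsion subgroup is everything. The order 4 comes from the equation
  \<open>(2 * a - 1) * c = a * (a - 1)\<close>, in which \<open>a\<close> is half of
  \<open>card L\<close>; its only positive solution is \<open>a = 1\<close>.\<close>

lemma prime_dvd_power_sum_diff:
  fixes f :: "'i \<Rightarrow> 'r :: comm_ring_1"
  assumes "finite I" and p: "Factorial_Ring.prime (p::nat)"
  shows "of_nat p dvd (\<Sum>i\<in>I. f i) ^ p - (\<Sum>i\<in>I. f i ^ p)"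
  using assms(1)
proof (induction I rule: finite_induct)
  case empty
  then show ?case using prime_gt_0_nat[OF p] by (simp add: power_0_left)
next
  case (insert j I)
  define a b where "a = f j" and "b = (\<Sum>i\<in>I. f i)"
  have p0: "p \<noteq> 0" using prime_gt_0_nat[OF p] by simp
  have "(a + b) ^ p = (\<Sum>k\<le>p. of_nat (p choose k) * a ^ k * b ^ (p - k))"
    by (rule binomial_ring)
  also have "{..p} = insert 0 (insert p {0<..<p})" using p0 by auto
  also have "(\<Sum>k\<in>insert 0 (insert p {0<..<p}). of_nat (p choose k) * a ^ k * b ^ (p - k))
      = b ^ p + (a ^ p + (\<Sum>k\<in>{0<..<p}. of_nat (p choose k) * a ^ k * b ^ (p - k)))"
    using p0 by simp
  finally have "(a + b) ^ p - (a ^ p + b ^ p) = (\<Sum>k\<in>{0<..<p}. of_nat (p choose k) * a ^ k * b ^ (p - k))"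
    by simp
  also have "of_nat p dvd \<dots>"
  proof (intro dvd_sum)
    fix k assume "k \<in> {0<..<p}"
    then have "p dvd (p choose k)" by (intro dvd_choose_prime) (use p in auto)
    then have "(of_nat p :: 'r) dvd of_nat (p choose k)" by (metis dvd_def of_nat_mult)
    then show "(of_nat p :: 'r) dvd of_nat (p choose k) * a ^ k * b ^ (p - k)"
      by (intro dvd_mult2)
  qed
  finally have "of_nat p dvd (a + b) ^ p - (a ^ p + b ^ p)" .
  from dvd_add[OF this insert.IH]
  show ?case using insert.hyps by (simp add: a_def b_def algebra_simps)
qed

lemma sum_card_swap:
  assumes "finite A" "finite B"
  shows "(\<Sum>z\<in>A. card {x \<in> B. P x z}) = (\<Sum>x\<in>B. card {z \<in> A. P x z})"
proof -
  have "(\<Sum>z\<in>A. card {x \<in> B. P x z}) = (\<Sum>z\<in>A. \<Sum>x\<in>B. if P x z then 1 else 0)"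
    using assms by (simp add: sum.inter_filter[symmetric])
  also have "\<dots> = (\<Sum>x\<in>B. \<Sum>z\<in>A. if P x z then 1 else 0)" by (rule sum.swap)
  also have "\<dots> = (\<Sum>x\<in>B. card {z \<in> A. P x z})"
    using assms by (simp add: sum.inter_filter[symmetric])
  finally show ?thesis .
qed

lemma sspanI:
  assumes "\<And>x. x \<notin> carrier G \<Longrightarrow> f x = 0"
    and "\<And>B x y. \<lbrakk>B \<in> S; x \<in> B; y \<in> B\<rbrakk> \<Longrightarrow> f x = f y"
  shows "f \<in> sspan G S"
  unfolding sspan_def gr_elem_def using assms by blast

lemma sspan_outside: "\<lbrakk>f \<in> sspan G S; x \<notin> carrier G\<rbrakk> \<Longrightarrow> f x = 0"
  unfolding sspan_def gr_elem_def by blast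

lemma sspan_constant: "\<lbrakk>f \<in> sspan G S; B \<in> S; x \<in> B; y \<in> B\<rbrakk> \<Longrightarrow> f x = f y"
  unfolding sspan_def by blast

text \<open>Since \<open>4 * a * (a - 1)\<close> is one less than the square of
  \<open>2 * a - 1\<close>, that odd number divides 1. The square is completed over
  \<open>int\<close> with \<open>k = a - 1\<close>, away from truncated subtraction.\<close>

lemma consecutive_product_odd_divisor:
  fixes a c :: nat
  assumes "(2 * a - 1) * c = a * (a - 1)" "0 < a"
  shows "a = 1"
proof -
  obtain k where k: "a = Suc k" using assms(2) by (cases a) auto
  have "(2 * int k + 1) * int c = (int k + 1) * int k"
    using arg_cong[OF assms(1), of int] by (simp add: k algebra_simps)
  then have "(2 * int k + 1) * (4 * int c - (2 * int k + 1)) = - 1" by (simp add: algebra_simps)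
  then have "2 * int k + 1 dvd - 1" by (metis dvd_triv_left)
  then have "2 * int k + 1 dvd 1" by (simp only: dvd_minus_iff)
  then have "2 * int k + 1 \<le> 1" by (rule zdvd_imp_le) simp
  then show ?thesis using k by simp
qed

section \<open>S-rings over finite cyclic groups\<close>

text \<open>The locale is interpreted again for subgroups and quotients with their own S-rings, so
  that the results on primitive S-rings apply there. The generator is therefore a parameter.\<close>

locale cyclic_sring = comm_group G for G (structure) +
  fixes S :: "'a set set" and g :: 'a
  assumes fin: "finite (carrier G)"
    and g_closed [simp]: "g \<in> carrier G"
    and cyc: "x \<in> carrier G \<Longrightarrow> \<exists>i::nat. x = g [^] i"
    and sring: "is_sring G S"
begin

text \<open>Since \<open>G\<close> is cyclic, its group ring is a quotient of \<open>\<int>[x]\<close>: \<open>ev\<close> substitutes \<open>g\<close> for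
  the indeterminate, so that Frobenius congruences can be proved for polynomials.\<close>

definition ev :: "int poly \<Rightarrow> 'a \<Rightarrow> int" where
  "ev P z = (\<Sum>i\<le>Polynomial.degree P. if z = g [^] i then poly.coeff P i else 0)"

lemma ev_eq: "Polynomial.degree P \<le> N \<Longrightarrow> ev P z = (\<Sum>i\<le>N. if z = g [^] i then poly.coeff P i else 0)"
  unfolding ev_def by (rule sum.mono_neutral_left) (auto simp: coeff_eq_0)

lemma ev_outside: "z \<notin> carrier G \<Longrightarrow> ev P z = 0"
  unfolding ev_def by (rule sum.neutral) (metis g_closed nat_pow_closed)

lemma ev_0: "ev 0 z = 0"
  unfolding ev_def by (rule sum.neutral) (auto simp: Polynomial.coeff_0)

lemma ev_add: "ev (P + Q) z = ev P z + ev Q z"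
proof -
  define N where "N = max (Polynomial.degree P) (Polynomial.degree Q)"
  have "Polynomial.degree (P + Q) \<le> N" unfolding N_def by (rule degree_add_le_max)
  then have "ev (P + Q) z = (\<Sum>i\<le>N. if z = g [^] i then poly.coeff (P + Q) i else 0)" by (rule ev_eq)
  also have "\<dots> = (\<Sum>i\<le>N. if z = g [^] i then poly.coeff P i else 0)
      + (\<Sum>i\<le>N. if z = g [^] i then poly.coeff Q i else 0)"
    unfolding sum.distrib[symmetric] by (rule sum.cong) auto
  finally show ?thesis unfolding N_def by (simp add: ev_eq[symmetric])
qed

lemma ev_smult: "ev (Polynomial.smult c P) z = c * ev P z"
  using ev_eq[OF degree_smult_le, of c P z]
  by (simp add: ev_def sum_distrib_left if_distrib cong: if_cong)

lemma ev_sum: "finite I \<Longrightarrow> ev (\<Sum>i\<in>I. F i) z = (\<Sum>i\<in>I. ev (F i) z)"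
  by (induction I rule: finite_induct) (simp_all add: ev_0 ev_add)

lemma ev_monom: "ev (Polynomial.monom c k) z = (if z = g [^] k then c else 0)"
proof -
  have "ev (Polynomial.monom c k) z = (\<Sum>i\<le>k. if z = g [^] i then poly.coeff (Polynomial.monom c k) i else 0)"
    by (rule ev_eq) (rule degree_monom_le)
  also have "\<dots> = (\<Sum>i\<in>{k}. if z = g [^] i then c else 0)"
    by (rule sum.mono_neutral_cong_right) auto
  finally show ?thesis by simp
qed

lemma ev_pCons:
  assumes z: "z \<in> carrier G"
  shows "ev (pCons a P) z = (if z = \<one> then a else 0) + ev P (inv g \<otimes> z)"
proof -
  have *: "z = g [^] Suc i \<longleftrightarrow> inv g \<otimes> z = g [^] i" for i
    by (metis g_closed inv_closed inv_solve_left' m_comm nat_pow_Suc nat_pow_closed z inv_solve_left)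
  have "ev (pCons a P) z = (\<Sum>i\<le>Suc (Polynomial.degree P). if z = g [^] i then poly.coeff (pCons a P) i else 0)"
    by (rule ev_eq) (simp add: degree_pCons_le)
  also have "\<dots> = (if z = \<one> then a else 0)
      + (\<Sum>i\<le>Polynomial.degree P. if z = g [^] Suc i then poly.coeff P i else 0)"
    by (subst sum.atMost_Suc_shift) (auto simp: coeff_pCons_0 coeff_pCons_Suc intro!: sum.cong)
  finally show ?thesis by (simp only: * ev_def)
qed

text \<open>Horner induction on \<open>P\<close>: by \<open>ev_pCons\<close>, multiplying by the
  indeterminate is translation by \<open>g\<close>, and reindexing the convolution by that
  translation moves it from the first factor to the argument.\<close>

lemma ev_mult: "ev (P * Q) z = conv G (ev P) (ev Q) z"
proof (cases "z \<in> carrier G")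
  case False
  then show ?thesis by (simp add: conv_def ev_outside)
next
  case True
  then show ?thesis
  proof (induction P arbitrary: z rule: pCons_induct)
    case 0
    then show ?case by (simp add: ev_0 conv_def)
  next
    case (pCons a P)
    have "conv G (ev (pCons a P)) (ev Q) z = (\<Sum>x\<in>carrier G. ev (pCons a P) x * ev Q (inv x \<otimes> z))"
      using pCons.prems by (simp add: conv_def)
    also have "\<dots> = (\<Sum>x\<in>carrier G. (if x = \<one> then a * ev Q z else 0) + ev P (inv g \<otimes> x) * ev Q (inv x \<otimes> z))"
      by (rule sum.cong) (auto simp: ev_pCons algebra_simps pCons.prems)
    also have "\<dots> = a * ev Q z + (\<Sum>x\<in>carrier G. ev P (inv g \<otimes> x) * ev Q (inv x \<otimes> z))"
      by (simp add: sum.distrib fin)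
    also have "(\<Sum>x\<in>carrier G. ev P (inv g \<otimes> x) * ev Q (inv x \<otimes> z))
        = (\<Sum>x\<in>carrier G. ev P x * ev Q (inv x \<otimes> (inv g \<otimes> z)))"
    proof (rule sum.reindex_bij_witness[where i="\<lambda>x. g \<otimes> x" and j="\<lambda>x. inv g \<otimes> x"])
      fix x assume x: "x \<in> carrier G"
      have "inv (inv g \<otimes> x) \<otimes> (inv g \<otimes> z) = (g \<otimes> inv g) \<otimes> (inv x \<otimes> z)"
        using x pCons.prems by (simp only: inv_mult inv_inv inv_closed m_closed g_closed m_ac)
      then show "ev P (inv g \<otimes> x) * ev Q (inv (inv g \<otimes> x) \<otimes> (inv g \<otimes> z)) = ev P (inv g \<otimes> x) * ev Q (inv x \<otimes> z)"
        using x pCons.prems by simp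
    qed (auto simp: m_assoc[symmetric])
    also have "\<dots> = ev (P * Q) (inv g \<otimes> z)"
      using pCons by (simp add: conv_def)
    finally show ?case using pCons.prems by (simp add: mult_pCons_left ev_add ev_smult ev_pCons)
  qed
qed

section \<open>Unions of basic sets\<close>

abbreviation aset :: "'a set \<Rightarrow> bool" where
  "aset W \<equiv> indic W \<in> sspan G S"

lemma part: "partition_on (carrier G) S"
  and one_S: "{\<one>} \<in> S"
  and inv_S: "B \<in> S \<Longrightarrow> (\<lambda>x. inv x) ` B \<in> S"
  and conv_sspan: "\<lbrakk>f \<in> sspan G S; h \<in> sspan G S\<rbrakk> \<Longrightarrow> conv G f h \<in> sspan G S"
  using sring unfolding is_sring_def by blast+

lemma S_sub: "B \<in> S \<Longrightarrow> B \<subseteq> carrier G"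
  and S_ne: "B \<in> S \<Longrightarrow> B \<noteq> {}"
  and S_eq: "\<lbrakk>B \<in> S; C \<in> S; x \<in> B; x \<in> C\<rbrakk> \<Longrightarrow> B = C"
  and S_cover: "x \<in> carrier G \<Longrightarrow> \<exists>B\<in>S. x \<in> B"
  using part unfolding partition_on_def disjoint_def by blast+

lemma S_one: "\<lbrakk>B \<in> S; \<one> \<in> B\<rbrakk> \<Longrightarrow> B = {\<one>}"
  using S_eq[OF _ one_S] by blast

lemma finite_S: "finite S"
  using finite_elements[OF fin part] .

lemma aset_iff: "aset W \<longleftrightarrow> W \<subseteq> carrier G \<and> (\<forall>B\<in>S. B \<subseteq> W \<or> B \<inter> W = {})"
  unfolding sspan_def gr_elem_def indic_def by (auto split: if_splits)

lemma aset_sub: "aset W \<Longrightarrow> W \<subseteq> carrier G"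
  and aset_cases: "\<lbrakk>aset W; B \<in> S\<rbrakk> \<Longrightarrow> B \<subseteq> W \<or> B \<inter> W = {}"
  by (auto simp: aset_iff)

lemma aset_basic: "B \<in> S \<Longrightarrow> aset B"
  unfolding aset_iff using S_sub S_eq by blast

lemma aset_Un: "\<lbrakk>aset W; aset Y\<rbrakk> \<Longrightarrow> aset (W \<union> Y)"
  unfolding aset_iff by blast

lemma aset_level:
  assumes "f \<in> sspan G S"
  shows "aset {x \<in> carrier G. Q (f x)}"
proof -
  have "f x = f y" if "B \<in> S" "x \<in> B" "y \<in> B" for x y B
    using sspan_constant[OF assms] that by blast
  then have "B \<subseteq> {x \<in> carrier G. Q (f x)} \<or> B \<inter> {x \<in> carrier G. Q (f x)} = {}" if "B \<in> S" for B
    using that S_sub[OF that] by (smt (verit) disjoint_iff mem_Collect_eq subset_iff)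
  then show ?thesis unfolding aset_iff by blast
qed

lemma mem_inv_image:
  assumes "W \<subseteq> carrier G" "x \<in> carrier G"
  shows "x \<in> (\<lambda>x. inv x) ` W \<longleftrightarrow> inv x \<in> W"
proof
  assume "inv x \<in> W"
  then have "inv (inv x) \<in> (\<lambda>x. inv x) ` W" by blast
  then show "x \<in> (\<lambda>x. inv x) ` W" using assms by simp
qed (use assms in auto)

lemma aset_inv:
  assumes "aset W"
  shows "aset ((\<lambda>x. inv x) ` W)"
  unfolding aset_iff
proof (intro conjI ballI)
  show "(\<lambda>x. inv x) ` W \<subseteq> carrier G" using aset_sub[OF assms] by auto
  fix B assume B: "B \<in> S"
  have mem: "inv x \<in> (\<lambda>x. inv x) ` B \<longleftrightarrow> x \<in> B" "x \<in> (\<lambda>x. inv x) ` W \<longleftrightarrow> inv x \<in> W"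
    if "x \<in> carrier G" for x
    using mem_inv_image[OF S_sub[OF B], of "inv x"] mem_inv_image[OF aset_sub[OF assms]] that by auto
  have "(\<lambda>x. inv x) ` B \<subseteq> W \<or> (\<lambda>x. inv x) ` B \<inter> W = {}"
    by (rule aset_cases[OF assms inv_S[OF B]])
  then show "B \<subseteq> (\<lambda>x. inv x) ` W \<or> B \<inter> (\<lambda>x. inv x) ` W = {}"
  proof
    assume "(\<lambda>x. inv x) ` B \<subseteq> W"
    then have "B \<subseteq> (\<lambda>x. inv x) ` W" using S_sub[OF B] mem by blast
    then show ?thesis ..
  next
    assume "(\<lambda>x. inv x) ` B \<inter> W = {}"
    then have "B \<inter> (\<lambda>x. inv x) ` W = {}" using S_sub[OF B] mem by blast
    then show ?thesis ..
  qed
qed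

text \<open>The count is the coefficient at \<open>z\<close> of the convolution of the inverted set
  \<open>W\<close> with \<open>Y\<close>, so closure under \<open>conv\<close> makes it constant on
  basic sets. Every count of quotients below rests on this.\<close>

lemma count_sspan:
  assumes W: "aset W" and Y: "aset Y"
  shows "(\<lambda>z. if z \<in> carrier G then int (card {x \<in> W. x \<otimes> z \<in> Y}) else 0) \<in> sspan G S"
proof -
  have sub: "W \<subseteq> carrier G" using aset_sub[OF W] .
  have "conv G (indic ((\<lambda>x. inv x) ` W)) (indic Y) z
      = (if z \<in> carrier G then int (card {x \<in> W. x \<otimes> z \<in> Y}) else 0)" for z
  proof (cases "z \<in> carrier G")
    case True
    have "(\<Sum>x\<in>carrier G. indic ((\<lambda>x. inv x) ` W) x * indic Y (inv x \<otimes> z))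
        = (\<Sum>x\<in>carrier G. indic W x * indic Y (x \<otimes> z))"
    proof (rule sum.reindex_bij_witness[where i="\<lambda>x. inv x" and j="\<lambda>x. inv x"])
      fix x assume x: "x \<in> carrier G"
      have "x \<in> (\<lambda>x. inv x) ` W \<longleftrightarrow> inv x \<in> W" using mem_inv_image[OF sub x] .
      then show "indic W (inv x) * indic Y (inv x \<otimes> z)
          = indic ((\<lambda>x. inv x) ` W) x * indic Y (inv x \<otimes> z)" by (simp add: indic_def)
    qed auto
    also have "\<dots> = (\<Sum>x\<in>{x \<in> W. x \<otimes> z \<in> Y}. 1)"
      by (rule sum.mono_neutral_cong_right) (use fin sub in \<open>auto simp: indic_def\<close>)
    finally show ?thesis using True by (simp add: conv_def)
  qed (simp add: conv_def)
  then show ?thesis using conv_sspan[OF aset_inv[OF W] Y] by presburger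
qed

lemma count_const:
  assumes "aset W" "aset Y" "B \<in> S" "z \<in> B" "w \<in> B"
  shows "card {x \<in> W. x \<otimes> z \<in> Y} = card {x \<in> W. x \<otimes> w \<in> Y}"
proof -
  have "z \<in> carrier G" "w \<in> carrier G" using S_sub[OF assms(3)] assms(4,5) by auto
  then show ?thesis using sspan_constant[OF count_sspan[OF assms(1,2)] assms(3-5)] by simp
qed

text \<open>The product set is the support of a convolution. The inverse of \<open>W\<close> appears
  because \<open>count_sspan\<close> already inverts its first argument.\<close>

lemma aset_mult:
  assumes W: "aset W" and Y: "aset Y"
  shows "aset (W <#> Y)"
proof -
  have sub: "W \<subseteq> carrier G" "Y \<subseteq> carrier G" using aset_sub W Y by auto
  let ?W = "(\<lambda>x. inv x) ` W"
  have "finite W" using sub fin finite_subset by blast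
  then have finW: "finite {x \<in> ?W. x \<otimes> z \<in> Y}" for z by simp
  have "W <#> Y = {z \<in> carrier G. card {x \<in> ?W. x \<otimes> z \<in> Y} \<noteq> 0}"
  proof (intro Set.set_eqI iffI)
    fix z assume "z \<in> W <#> Y"
    then obtain x y where xy: "x \<in> W" "y \<in> Y" "z = x \<otimes> y" unfolding set_mult_def by auto
    then have "inv x \<otimes> z = y" using sub by (simp add: subset_iff m_assoc[symmetric])
    then have "inv x \<in> {x \<in> ?W. x \<otimes> z \<in> Y}" using xy by auto
    then show "z \<in> {z \<in> carrier G. card {x \<in> ?W. x \<otimes> z \<in> Y} \<noteq> 0}"
      using finW xy sub by (auto simp: card_eq_0_iff)
  next
    fix z assume "z \<in> {z \<in> carrier G. card {x \<in> ?W. x \<otimes> z \<in> Y} \<noteq> 0}"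
    then obtain x where z: "z \<in> carrier G" and x: "x \<in> W" "inv x \<otimes> z \<in> Y"
      by (auto simp: card_eq_0_iff)
    moreover have "z = x \<otimes> (inv x \<otimes> z)" using z x sub by (simp add: subset_iff m_assoc[symmetric])
    ultimately show "z \<in> W <#> Y" unfolding set_mult_def by blast
  qed
  also have "\<dots> = {z \<in> carrier G. (if z \<in> carrier G then int (card {x \<in> ?W. x \<otimes> z \<in> Y}) else 0) \<noteq> 0}"
    by auto
  finally show ?thesis
    using aset_level[OF count_sspan[OF aset_inv[OF W] Y], of "\<lambda>c. c \<noteq> 0"] by simp
qed

section \<open>Generated A-subgroups and radicals\<close>

lemma stabI:
  assumes "T \<subseteq> carrier G" "h \<in> carrier G" "\<And>t. t \<in> T \<Longrightarrow> t \<otimes> h \<in> T"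
  shows "(\<lambda>t. t \<otimes> h) ` T = T"
proof (rule endo_inj_surj)
  show "finite T" using assms(1) fin finite_subset by blast
  show "inj_on (\<lambda>t. t \<otimes> h) T" using assms(1,2) by (auto intro!: inj_onI simp: subset_iff)
qed (use assms(3) in auto)

lemma aset_generate:
  assumes W: "aset W"
  shows "aset (generate G W)"
proof -
  have sub: "W \<subseteq> carrier G" using aset_sub[OF W] .
  have gsub: "subgroup (generate G W) G" using generate_is_subgroup[OF sub] .
  \<comment> \<open>A maximal union of basic sets inside \<open>generate G W\<close> is stable under multiplication by \<open>W\<close>.\<close>
  define \<C> where "\<C> = {T. aset T \<and> T \<subseteq> generate G W \<and> \<one> \<in> T}"
  have "finite \<C>"
    by (rule finite_subset[of _ "Pow (carrier G)"]) (auto simp: \<C>_def fin dest: aset_sub)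
  moreover have "{\<one>} \<in> \<C>"
    using aset_basic[OF one_S] generate.one[of G W] by (auto simp: \<C>_def)
  ultimately obtain T where T: "T \<in> \<C>" and max: "\<And>T'. T' \<in> \<C> \<Longrightarrow> T \<subseteq> T' \<Longrightarrow> T = T'"
    using finite_has_maximal[of \<C>] by blast
  have Tsub: "T \<subseteq> carrier G" using T aset_sub by (auto simp: \<C>_def)
  have X1: "aset (W \<union> {\<one>})" by (intro aset_Un W aset_basic one_S)
  have "T <#> (W \<union> {\<one>}) \<in> \<C>"
    unfolding \<C>_def mem_Collect_eq
  proof (intro conjI)
    show "aset (T <#> (W \<union> {\<one>}))" using T X1 aset_mult by (simp add: \<C>_def)
    show "T <#> (W \<union> {\<one>}) \<subseteq> generate G W"
      using T subgroup.m_closed[OF gsub] generate.incl[of _ W G] generate.one[of G W]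
      unfolding set_mult_def \<C>_def by blast
    have "\<one> \<otimes> \<one> \<in> T <#> (W \<union> {\<one>})" unfolding set_mult_def using T unfolding \<C>_def by blast
    then show "\<one> \<in> T <#> (W \<union> {\<one>})" by simp
  qed
  moreover have "T \<subseteq> T <#> (W \<union> {\<one>})"
  proof
    fix t assume t: "t \<in> T"
    then have "t \<otimes> \<one> \<in> T <#> (W \<union> {\<one>})" unfolding set_mult_def by blast
    then show "t \<in> T <#> (W \<union> {\<one>})" using t Tsub by auto
  qed
  ultimately have eq: "T = T <#> (W \<union> {\<one>})" by (rule max)
  have step: "t \<otimes> x \<in> T" if "t \<in> T" "x \<in> W" for t x
    using that eq unfolding set_mult_def by blast
  \<comment> \<open>The induction carries equality of sets instead of inclusion, because an equality
    can be translated back by \<open>inv h\<close> in the case of inverses.\<close>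
  have stab: "(\<lambda>t. t \<otimes> h) ` T = T" if "h \<in> generate G W" for h
    using that
  proof (induction rule: generate.induct)
    case one
    have "t \<otimes> \<one> = t" if "t \<in> T" for t using that Tsub by auto
    then show ?case by simp
  next
    case (incl h)
    then show ?case using stabI[OF Tsub] step sub by blast
  next
    case (inv h)
    have "(\<lambda>t. t \<otimes> h) ` T = T" using stabI[OF Tsub] step sub inv by blast
    then have "(\<lambda>t. t \<otimes> inv h) ` T = (\<lambda>t. t \<otimes> inv h) ` (\<lambda>t. t \<otimes> h) ` T" by simp
    also have "\<dots> = T"
    proof -
      have "t \<otimes> h \<otimes> inv h = t" if "t \<in> T" for t
        using that Tsub sub inv by (simp add: subset_iff m_assoc)
      then show ?thesis by (simp add: image_image)
    qed
    finally show ?case .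
  next
    case (eng h1 h2)
    have c: "h1 \<in> carrier G" "h2 \<in> carrier G" using eng sub generate_in_carrier by auto
    have "(\<lambda>t. t \<otimes> (h1 \<otimes> h2)) ` T = (\<lambda>t. t \<otimes> h2) ` (\<lambda>t. t \<otimes> h1) ` T"
      unfolding image_image using Tsub c by (intro image_cong refl) (simp add: subset_iff m_assoc)
    then show ?case using eng by simp
  qed
  have "generate G W \<subseteq> T"
  proof
    fix h assume h: "h \<in> generate G W"
    then have "\<one> \<otimes> h \<in> T" using stab T by (auto simp: \<C>_def)
    then show "h \<in> T" using h sub generate_in_carrier by auto
  qed
  then have "T = generate G W" using T by (auto simp: \<C>_def)
  then show ?thesis using T by (simp add: \<C>_def)
qed

lemma a_subgroup_generate: "aset W \<Longrightarrow> a_subgroup G S (generate G W)"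
  unfolding a_subgroup_def using aset_generate generate_is_subgroup aset_sub by blast

text \<open>The radical of \<open>W\<close>, that is, its stabilizer under translations. As
  \<open>W\<close> is finite, being mapped into itself is the same as being mapped onto
  itself.\<close>

definition rad :: "'a set \<Rightarrow> 'a set" where
  "rad W = {z \<in> carrier G. \<forall>x\<in>W. x \<otimes> z \<in> W}"

text \<open>The number of \<open>x\<close> in \<open>W\<close> with \<open>x \<otimes> z\<close> in
  \<open>W\<close> reaches its maximum \<open>card W\<close> exactly on the radical, which is thus a
  level set of a function that is constant on basic sets.\<close>

lemma a_subgroup_rad:
  assumes W: "aset W"
  shows "a_subgroup G S (rad W)"
proof -
  have sub: "W \<subseteq> carrier G" using aset_sub[OF W] .
  then have finW: "finite W" using fin finite_subset by blast
  have iff: "(\<forall>x\<in>W. x \<otimes> z \<in> W) \<longleftrightarrow> card {x \<in> W. x \<otimes> z \<in> W} = card W" for z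
  proof
    assume "card {x \<in> W. x \<otimes> z \<in> W} = card W"
    then have "{x \<in> W. x \<otimes> z \<in> W} = W" by (intro card_subset_eq finW Collect_subset)
    from equalityD2[OF this] show "\<forall>x\<in>W. x \<otimes> z \<in> W" by blast
  next
    assume "\<forall>x\<in>W. x \<otimes> z \<in> W"
    then have "{x \<in> W. x \<otimes> z \<in> W} = W" by blast
    then show "card {x \<in> W. x \<otimes> z \<in> W} = card W" by simp
  qed
  define F where "F = (\<lambda>z. if z \<in> carrier G then int (card {x \<in> W. x \<otimes> z \<in> W}) else 0)"
  have F: "F \<in> sspan G S" unfolding F_def by (rule count_sspan[OF W W])
  have "(F z = int (card W)) = (\<forall>x\<in>W. x \<otimes> z \<in> W)" if "z \<in> carrier G" for z
    unfolding iff F_def using that by (simp only: if_True of_nat_eq_iff)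
  then have eq: "{z \<in> carrier G. F z = int (card W)} = rad W"
    unfolding rad_def by blast
  have "aset {z \<in> carrier G. F z = int (card W)}"
    by (rule aset_level[OF F])
  then have "aset (rad W)" by (simp only: eq)
  moreover have "subgroup (rad W) G"
  proof (rule subgroupI)
    have "\<one> \<in> rad W" using sub by (auto simp: rad_def)
    then show "rad W \<noteq> {}" by blast
  next
    fix a assume a: "a \<in> rad W"
    then have ac: "a \<in> carrier G" by (simp add: rad_def)
    have im: "(\<lambda>t. t \<otimes> a) ` W = W" by (rule stabI[OF sub ac]) (use a in \<open>simp add: rad_def\<close>)
    have "x \<otimes> inv a \<in> W" if x: "x \<in> W" for x
    proof -
      obtain t where t: "t \<in> W" "x = t \<otimes> a" using equalityD2[OF im] x by blast
      then have "x \<otimes> inv a = t" using sub ac by (simp add: subset_iff m_assoc)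
      then show ?thesis using t by simp
    qed
    then show "inv a \<in> rad W" using ac by (simp add: rad_def)
  next
    fix a b assume ab: "a \<in> rad W" "b \<in> rad W"
    have "x \<otimes> (a \<otimes> b) \<in> W" if "x \<in> W" for x
    proof -
      have "x \<otimes> a \<otimes> b \<in> W" using ab that by (simp add: rad_def)
      then show ?thesis using ab that sub by (simp add: rad_def m_assoc subset_iff)
    qed
    then show "a \<otimes> b \<in> rad W" using ab by (simp add: rad_def)
  next
    show "rad W \<subseteq> carrier G" by (auto simp: rad_def)
  qed
  ultimately show ?thesis by (simp add: a_subgroup_def)
qed

section \<open>Powers in the group ring modulo a prime\<close>

lemma sspan_ev_power:
  assumes "ev P \<in> sspan G S"
  shows "ev (P ^ k) \<in> sspan G S"
proof (induction k)
  case 0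
  have "ev 1 = indic {\<one>}"
    using ev_monom[of 1 0] by (auto simp: indic_def fun_eq_iff)
  then show ?case using aset_basic[OF one_S] by simp
next
  case (Suc k)
  have "ev (P ^ Suc k) = conv G (ev P) (ev (P ^ k))" by (simp add: ev_mult fun_eq_iff)
  then show ?case using conv_sspan[OF assms Suc] by simp
qed

lemma aset_frobenius:
  assumes W: "aset W" and p: "Factorial_Ring.prime (p::nat)"
  shows "aset {y \<in> carrier G. \<not> p dvd card {x \<in> W. x [^] p = y}}"
proof -
  have sub: "W \<subseteq> carrier G" using aset_sub[OF W] .
  then have finW: "finite W" using fin finite_subset by blast
  \<comment> \<open>Choosing an exponent for each element lifts \<open>W\<close> to a polynomial
    with one monomial per element, whose evaluation is \<open>indic W\<close>.\<close>
  define e where "e x = (SOME i::nat. x = g [^] i)" for x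
  have e: "g [^] e x = x" if "x \<in> W" for x
    using someI_ex[OF cyc[of x]] that sub unfolding e_def by auto
  define P where "P = (\<Sum>x\<in>W. Polynomial.monom (1::int) (e x))"
  have "ev P = indic W"
    unfolding P_def fun_eq_iff ev_sum[OF finW] ev_monom
    using e finW by (auto simp: indic_def)
  then have F: "ev (P ^ p) \<in> sspan G S" using W by (intro sspan_ev_power) simp
  \<comment> \<open>Modulo \<open>p\<close> the \<open>p\<close>-th convolution power of \<open>W\<close> is the sum of the \<open>x [^] p\<close> over \<open>W\<close>.\<close>
  have "of_nat p dvd P ^ p - (\<Sum>x\<in>W. Polynomial.monom 1 (e x) ^ p)"
    unfolding P_def by (rule prime_dvd_power_sum_diff[OF finW p])
  then obtain Q where Q: "P ^ p = (\<Sum>x\<in>W. Polynomial.monom 1 (e x) ^ p) + Polynomial.smult (int p) Q"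
  proof
    fix Q assume "P ^ p - (\<Sum>x\<in>W. Polynomial.monom 1 (e x) ^ p) = of_nat p * Q"
    then show thesis using that[of Q] by (simp add: of_nat_poly algebra_simps)
  qed
  have "ev (P ^ p) y = int (card {x \<in> W. x [^] p = y}) + int p * ev Q y" for y
  proof -
    have "ev (P ^ p) y = (\<Sum>x\<in>W. if y = x [^] p then 1 else 0) + int p * ev Q y"
      unfolding Q ev_add ev_smult ev_sum[OF finW] monom_power
      by (simp add: ev_monom nat_pow_pow[symmetric] e)
    also have "(\<Sum>x\<in>W. if y = x [^] p then 1 else 0) = (\<Sum>x\<in>{x \<in> W. x [^] p = y}. 1::int)"
      by (rule sum.mono_neutral_cong_right) (use finW in auto)
    finally show ?thesis by simp
  qed
  then have "p dvd card {x \<in> W. x [^] p = y} \<longleftrightarrow> int p dvd ev (P ^ p) y" for y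
    by (simp add: dvd_add_left_iff)
  then show ?thesis using aset_level[OF F, of "\<lambda>c. \<not> int p dvd c"] by simp
qed

section \<open>Powers and multipliers\<close>

lemma order_pos: "0 < order G"
  using fin order_gt_0_iff_finite by blast

lemma generate_g: "generate G {g} = carrier G"
proof -
  have "carrier G \<subseteq> generate G {g}"
  proof
    fix x assume "x \<in> carrier G"
    then obtain i :: nat where "x = g [^] i" using cyc by blast
    then show "x \<in> generate G {g}"
      unfolding generate_pow[OF g_closed] by (auto simp: int_pow_int[symmetric])
  qed
  then show ?thesis using generate_incl[of "{g}"] by auto
qed

lemma pow_g_eq_one: "g [^] (k::nat) = \<one> \<longleftrightarrow> order G dvd k"
proof -
  have "ord g = order G" using generate_pow_card[OF g_closed] generate_g by (simp add: order_def)
  then show ?thesis using pow_eq_id[OF g_closed] by simp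
qed

lemma ex_pow_less: "x \<in> carrier G \<Longrightarrow> \<exists>i. i < order G \<and> x = g [^] i"
proof -
  assume "x \<in> carrier G"
  then obtain i :: nat where i: "x = g [^] i" using cyc by blast
  have "g [^] i = g [^] (order G * (i div order G) + i mod order G)" by simp
  also have "\<dots> = g [^] (i mod order G)"
    unfolding nat_pow_mult[OF g_closed, symmetric] using pow_g_eq_one[of "order G * (i div order G)"] by simp
  finally show ?thesis using i order_pos by (intro exI[of _ "i mod order G"]) simp
qed

text \<open>If \<open>x = g [^] i\<close> with \<open>i < order G\<close>, then
  \<open>x [^] d = \<one>\<close> makes \<open>i\<close> a multiple of
  \<open>order G div gcd (order G) d\<close>, which leaves \<open>gcd (order G) d\<close> values.
  This bound is the arithmetic use of cyclicity: it determines subgroups by their order and limits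
  the fibres of power maps.\<close>

lemma card_torsion_le:
  assumes "0 < (d::nat)"
  shows "card {x \<in> carrier G. x [^] d = \<one>} \<le> d"
proof -
  define c where "c = gcd (order G) d"
  define e where "e = order G div c"
  have c0: "0 < c" using assms by (simp add: c_def)
  have n: "order G = e * c" unfolding e_def c_def by simp
  have "{x \<in> carrier G. x [^] d = \<one>} \<subseteq> (\<lambda>j. g [^] (j * e)) ` {..<c}"
  proof
    fix x assume "x \<in> {x \<in> carrier G. x [^] d = \<one>}"
    then have x: "x \<in> carrier G" "x [^] d = \<one>" by auto
    from ex_pow_less[OF x(1)] obtain i where i: "i < order G" "x = g [^] i" by blast
    have "g [^] (i * d) = \<one>" using x(2) i(2) by (simp add: nat_pow_pow)
    then have "order G dvd i * d" using pow_g_eq_one by simp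
    moreover have "d div c * c = d" by (simp add: c_def)
    ultimately have "e * c dvd i * (d div c) * c" by (simp only: n mult.assoc)
    then have "e dvd i * (d div c)" using c0 by simp
    moreover have "coprime e (d div c)" unfolding e_def c_def using assms
      by (intro div_gcd_coprime) simp
    ultimately have "e dvd i" by (simp add: coprime_dvd_mult_left_iff)
    then obtain j where "i = j * e" by (metis dvd_def mult.commute)
    moreover from this have "j < c" using i(1) unfolding n by (simp add: mult.commute)
    ultimately show "x \<in> (\<lambda>j. g [^] (j * e)) ` {..<c}" using i by blast
  qed
  then have "card {x \<in> carrier G. x [^] d = \<one>} \<le> card ((\<lambda>j. g [^] (j * e)) ` {..<c})"
    by (intro card_mono) auto
  also have "\<dots> \<le> c" using card_image_le[of "{..<c}"] by simp
  also have "\<dots> \<le> d" unfolding c_def using assms by (intro gcd_le2_nat) simp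
  finally show ?thesis .
qed

lemma subgroup_pow_card:
  assumes H: "subgroup H G" and x: "x \<in> H"
  shows "x [^] card H = \<one>"
proof -
  interpret K: group "G\<lparr>carrier := H\<rparr>" using subgroup.subgroup_is_group[OF H is_group] .
  have "x [^]\<^bsub>G\<lparr>carrier := H\<rparr>\<^esub> order (G\<lparr>carrier := H\<rparr>) = \<one>"
    using K.pow_order_eq_1[of x] x by simp
  then show ?thesis by (simp add: order_def nat_pow_consistent[symmetric])
qed

text \<open>Lagrange gives one inclusion and the torsion bound the equality. Membership in a
  subgroup thereby becomes an equation between powers.\<close>

lemma subgroup_eq_torsion:
  assumes H: "subgroup H G"
  shows "H = {x \<in> carrier G. x [^] card H = \<one>}"
proof (rule card_seteq)
  have "finite H" using subgroup.subset[OF H] fin finite_subset by blast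
  then have "0 < card H" using subgroup.one_closed[OF H] by (auto simp: card_gt_0_iff)
  then show "card {x \<in> carrier G. x [^] card H = \<one>} \<le> card H" by (rule card_torsion_le)
  show "H \<subseteq> {x \<in> carrier G. x [^] card H = \<one>}"
    using subgroup_pow_card[OF H] subgroup.subset[OF H] by blast
qed (use fin in simp)

lemma subgroup_torsion: "subgroup {x \<in> carrier G. x [^] (k::nat) = \<one>} G"
  by (rule subgroupI) (auto simp: nat_pow_inv pow_mult_distrib m_comm)

lemma pow_g_div_neq_one:
  assumes "p dvd order G" "1 < p"
  shows "g [^] (order G div p) \<noteq> \<one>"
proof
  assume "g [^] (order G div p) = \<one>"
  then have "order G dvd order G div p" by (simp add: pow_g_eq_one)
  moreover have "0 < order G div p" using assms order_pos by (simp add: dvd_imp_le div_greater_zero_iff)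
  ultimately have "order G \<le> order G div p" by (rule dvd_imp_le)
  then show False using div_less_dividend[OF assms(2) order_pos] by simp
qed

lemma ex_torsion:
  assumes "p dvd order G" "1 < p"
  shows "\<exists>z\<in>carrier G. z \<noteq> \<one> \<and> z [^] p = \<one>"
proof (intro bexI conjI)
  show "g [^] (order G div p) \<noteq> \<one>" by (rule pow_g_div_neq_one[OF assms])
  show "(g [^] (order G div p)) [^] p = \<one>"
    using assms(1) by (simp add: nat_pow_pow pow_g_eq_one)
qed simp

lemma coprime_pow_inverse:
  assumes "coprime m (order G)" "0 < m"
  shows "\<exists>q. 0 < q \<and> coprime q (order G) \<and> (\<forall>x\<in>carrier G. (x [^] m) [^] q = x)"
proof -
  obtain q k where q: "m * q = order G * k + 1"
    using bezout_nat[of m "order G"] assms by auto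
  have "(x [^] m) [^] q = x" if x: "x \<in> carrier G" for x
  proof -
    have "(x [^] m) [^] q = (x [^] order G) [^] k \<otimes> x"
      unfolding nat_pow_pow[OF x] q using x by (simp add: nat_pow_mult[symmetric])
    then show ?thesis using x pow_order_eq_1[OF x] by simp
  qed
  moreover have "coprime q (order G)"
  proof (rule coprimeI)
    fix c assume "c dvd q" "c dvd order G"
    then have "c dvd order G * k + 1" "c dvd order G * k" using q by (metis dvd_mult, simp)
    then show "is_unit c" by (simp only: dvd_add_right_iff)
  qed
  moreover have "0 < q" using q by (cases q) auto
  ultimately show ?thesis by blast
qed

text \<open>Prime factors \<open>p\<close> of \<open>m\<close> are split off one at a time. As
  \<open>p\<close> is coprime to the order, fibres of the \<open>p\<close>-th power have at most one
  element, so the A-set supplied by \<open>aset_frobenius\<close> is exactly the image.\<close>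

lemma aset_pow:
  assumes "coprime m (order G)" "0 < m" "aset W"
  shows "aset ((\<lambda>x. x [^] m) ` W)"
  using assms
proof (induction m arbitrary: W rule: less_induct)
  case (less m)
  have sub: "W \<subseteq> carrier G" using aset_sub less.prems by blast
  show ?case
  proof (cases "m = 1")
    case True
    have "(\<lambda>x. x [^] m) ` W = id ` W" using sub True by (intro image_cong) auto
    then show ?thesis using less.prems by simp
  next
    case False
    then obtain p where p: "Factorial_Ring.prime p" "p dvd m" using prime_factor_nat by blast
    then obtain k where k: "m = p * k" by blast
    have p1: "1 < p" using prime_gt_1_nat p by blast
    have k0: "0 < k" and km: "k < m" using less.prems k p1 by auto
    have cop: "coprime k (order G)" "coprime p (order G)" using less.prems k by auto
    have Wk: "aset ((\<lambda>x. x [^] k) ` W)" using less.IH[OF km cop(1) k0 less.prems(3)] .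
    let ?V = "(\<lambda>x. x [^] k) ` W"
    have Vsub: "?V \<subseteq> carrier G" using sub by auto
    obtain q :: nat where q: "\<forall>x\<in>carrier G. (x [^] p) [^] q = x"
      using coprime_pow_inverse[OF cop(2) prime_gt_0_nat[OF p(1)]] by blast
    have "{y \<in> carrier G. \<not> p dvd card {x \<in> ?V. x [^] p = y}} = (\<lambda>x. x [^] p) ` ?V"
    proof (intro Set.set_eqI iffI)
      fix y assume y: "y \<in> {y \<in> carrier G. \<not> p dvd card {x \<in> ?V. x [^] p = y}}"
      then have "{x \<in> ?V. x [^] p = y} \<noteq> {}" by (intro notI) simp
      then show "y \<in> (\<lambda>x. x [^] p) ` ?V" by blast
    next
      fix y assume "y \<in> (\<lambda>x. x [^] p) ` ?V"
      then obtain v where v: "v \<in> ?V" "y = v [^] p" by blast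
      have "x = v" if "x \<in> ?V" "x [^] p = y" for x
      proof -
        have "x \<in> carrier G" "v \<in> carrier G" using that(1) v(1) Vsub by blast+
        then have "x = (x [^] p) [^] q" "v = (v [^] p) [^] q" using q by simp_all
        then show ?thesis unfolding that(2) v(2)[symmetric] by (rule trans[OF _ sym])
      qed
      then have "{x \<in> ?V. x [^] p = y} = {v}" using v by blast
      then have "\<not> p dvd card {x \<in> ?V. x [^] p = y}" using p1 by simp
      moreover have "y \<in> carrier G" using v Vsub by blast
      ultimately show "y \<in> {y \<in> carrier G. \<not> p dvd card {x \<in> ?V. x [^] p = y}}" by blast
    qed
    moreover have "(\<lambda>x. x [^] p) ` ?V = (\<lambda>x. x [^] m) ` W"
      unfolding image_image using sub
      by (intro image_cong refl) (auto simp: nat_pow_pow k mult.commute)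
    ultimately show ?thesis using aset_frobenius[OF Wk p(1)] by simp
  qed
qed

text \<open>The image is an A-set by \<open>aset_pow\<close>. A basic set \<open>C\<close> inside
  it, pulled back with the inverse exponent \<open>q\<close>, is a nonempty A-set inside
  \<open>B\<close>, hence all of \<open>B\<close>; so the image is \<open>C\<close> alone.\<close>

lemma basic_pow:
  assumes m: "coprime m (order G)" "0 < m" and B: "B \<in> S"
  shows "(\<lambda>x. x [^] m) ` B \<in> S"
proof -
  obtain q where q: "0 < q" "coprime q (order G)" "\<And>x. x \<in> carrier G \<Longrightarrow> (x [^] m) [^] q = x"
    using coprime_pow_inverse[OF m] by blast
  have inv1: "(\<lambda>x. x [^] q) ` (\<lambda>x. x [^] m) ` W = W" if "W \<subseteq> carrier G" for W
  proof -
    have "(\<lambda>x. (x [^] m) [^] q) ` W = id ` W" using that q(3) by (intro image_cong) auto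
    then show ?thesis by (simp add: image_image)
  qed
  have q': "(x [^] q) [^] m = x" if "x \<in> carrier G" for x
    using q(3)[OF that] that by (simp add: nat_pow_pow mult.commute)
  have inv2: "(\<lambda>x. x [^] m) ` (\<lambda>x. x [^] q) ` W = W" if "W \<subseteq> carrier G" for W
  proof -
    have "(\<lambda>x. (x [^] q) [^] m) ` W = id ` W" using that q' by (intro image_cong) auto
    then show ?thesis by (simp add: image_image)
  qed
  obtain b where b: "b \<in> B" using S_ne[OF B] by blast
  have "b [^] m \<in> carrier G" using b S_sub[OF B] by auto
  then obtain C where C: "C \<in> S" "b [^] m \<in> C" using S_cover by blast
  have "C \<subseteq> (\<lambda>x. x [^] m) ` B"
    using aset_cases[OF aset_pow[OF m aset_basic[OF B]] C(1)] C(2) b by blast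
  then have "(\<lambda>x. x [^] q) ` C \<subseteq> (\<lambda>x. x [^] q) ` (\<lambda>x. x [^] m) ` B" by (rule image_mono)
  then have CB: "(\<lambda>x. x [^] q) ` C \<subseteq> B" using inv1[OF S_sub[OF B]] by simp
  have "B \<subseteq> (\<lambda>x. x [^] q) ` C"
    using aset_cases[OF aset_pow[OF q(2,1) aset_basic[OF C(1)]] B] CB S_ne[OF C(1)] by blast
  with CB have "B = (\<lambda>x. x [^] q) ` C" by blast
  then have "(\<lambda>x. x [^] m) ` B = C" using inv2[OF S_sub[OF C(1)]] by simp
  then show ?thesis using C(1) by simp
qed

text \<open>Elements of \<open>E\<close> are \<open>p\<close>-th powers, which gives the first
  property. If \<open>x [^] p\<close> is outside \<open>E\<close>, its fibre in \<open>W\<close>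
  contains \<open>x\<close> and has size divisible by \<open>p\<close>, hence at least
  \<open>p\<close>; it lies in the coset of \<open>x\<close> modulo the solutions of
  \<open>z [^] p = \<one>\<close>, which has at most \<open>p\<close> elements. So the fibre is that
  coset.\<close>

lemma frobenius_spread:
  assumes W: "aset W" and p: "Factorial_Ring.prime (p::nat)" "p dvd order G"
  obtains E where "aset E" "\<And>y. y \<in> E \<Longrightarrow> y [^] (order G div p) = \<one>"
    "\<And>x z. \<lbrakk>x \<in> W; x [^] p \<notin> E; z \<in> carrier G; z [^] p = \<one>\<rbrakk> \<Longrightarrow> x \<otimes> z \<in> W"
proof
  let ?E = "{y \<in> carrier G. \<not> p dvd card {x \<in> W. x [^] p = y}}"
  have sub: "W \<subseteq> carrier G" using aset_sub[OF W] .
  show "aset ?E" by (rule aset_frobenius[OF W p(1)])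
  show "y [^] (order G div p) = \<one>" if y: "y \<in> ?E" for y
  proof -
    have "{x \<in> W. x [^] p = y} \<noteq> {}" using y by (intro notI) simp
    then obtain x where x: "x \<in> W" "y = x [^] p" by blast
    have "p * (order G div p) = order G" using p(2) by simp
    then show ?thesis using x sub pow_order_eq_1[of x] by (auto simp: nat_pow_pow)
  qed
  fix x z assume x: "x \<in> W" "x [^] p \<notin> ?E" and z: "z \<in> carrier G" "z [^] p = \<one>"
  have xc: "x \<in> carrier G" using x sub by blast
  let ?P = "{z \<in> carrier G. z [^] p = \<one>}"
  let ?F = "{w \<in> W. w [^] p = x [^] p}"
  have finF: "finite ?F" using finite_subset[OF sub fin] by simp
  have "p dvd card ?F" using x xc by auto
  moreover have "card ?F \<noteq> 0" using finF x by (auto simp: card_eq_0_iff)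
  ultimately have le: "p \<le> card ?F" by (auto dest: dvd_imp_le)
  have FP: "?F \<subseteq> (\<lambda>z. x \<otimes> z) ` ?P"
  proof
    fix w assume "w \<in> ?F"
    then have w: "w \<in> W" "w \<in> carrier G" "w [^] p = x [^] p" using sub by auto
    have "(inv x \<otimes> w) [^] p = \<one>"
      using w xc by (simp add: pow_mult_distrib m_comm nat_pow_inv)
    moreover have "w = x \<otimes> (inv x \<otimes> w)" using w xc by (simp add: m_assoc[symmetric])
    ultimately show "w \<in> (\<lambda>z. x \<otimes> z) ` ?P" using w xc by blast
  qed
  have finP: "finite ?P" using fin by simp
  have "card ((\<lambda>z. x \<otimes> z) ` ?P) \<le> card ?P" using card_image_le[OF finP] .
  also have "\<dots> \<le> p" using card_torsion_le[of p] prime_gt_0_nat[OF p(1)] by simp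
  finally have eq: "?F = (\<lambda>z. x \<otimes> z) ` ?P"
    using card_seteq[OF _ FP] finP le by simp
  have "x \<otimes> z \<in> (\<lambda>z. x \<otimes> z) ` ?P" using z by blast
  then show "x \<otimes> z \<in> W" unfolding eq[symmetric] by simp
qed

section \<open>Primitive S-rings\<close>

lemma card_translate:
  assumes "x \<in> carrier G" "Y \<subseteq> carrier G"
  shows "card {z \<in> carrier G. x \<otimes> z \<in> Y} = card Y"
proof (rule bij_betw_same_card[where f="\<lambda>z. x \<otimes> z"])
  show "bij_betw (\<lambda>z. x \<otimes> z) {z \<in> carrier G. x \<otimes> z \<in> Y} Y"
  proof (rule bij_betw_byWitness[where f'="\<lambda>y. inv x \<otimes> y"])
    show "\<forall>a\<in>{z \<in> carrier G. x \<otimes> z \<in> Y}. inv x \<otimes> (x \<otimes> a) = a"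
      using assms by (auto simp: m_assoc[symmetric])
    show *: "\<forall>a'\<in>Y. x \<otimes> (inv x \<otimes> a') = a'"
      using assms by (auto simp: m_assoc[symmetric] subset_iff)
    show "(\<lambda>z. x \<otimes> z) ` {z \<in> carrier G. x \<otimes> z \<in> Y} \<subseteq> Y" by blast
    show "(\<lambda>y. inv x \<otimes> y) ` Y \<subseteq> {z \<in> carrier G. x \<otimes> z \<in> Y}"
      using assms * by auto
  qed
qed

text \<open>Let \<open>P\<close> be the subgroup of order \<open>p\<close>. In a primitive S-ring every basic set other than \<open>{\<one>}\<close>
  meets \<open>P\<close>, and outside \<open>P\<close> it is a union of \<open>P\<close>-cosets. Double counting the quotients of a
  smallest basic set then forces it into \<open>P\<close>.\<close>

theorem primitive_imp_prime:
  assumes prim: "\<And>H. \<not> nontriv_a_subgroup G S H" and rk: "3 \<le> card S"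
  shows "Factorial_Ring.prime (order G)"
proof -
  have triv: "H = {\<one>} \<or> H = carrier G" if "a_subgroup G S H" for H
    using prim[of H] that by (auto simp: nontriv_a_subgroup_def)
  have gen: "generate G W = carrier G" if W: "aset W" "W \<noteq> {}" "W \<noteq> {\<one>}" for W
  proof -
    have inc: "W \<subseteq> generate G W" by (intro subsetI generate.incl)
    have "generate G W \<noteq> {\<one>}"
    proof
      assume "generate G W = {\<one>}"
      with inc have "W \<subseteq> {\<one>}" by simp
      from subset_singletonD[OF this] show False using W(2,3) by simp
    qed
    with triv[OF a_subgroup_generate[OF W(1)]] show ?thesis by simp
  qed
  obtain A B where AB: "A \<in> S" "B \<in> S" "A \<noteq> B" "A \<noteq> {\<one>}" "B \<noteq> {\<one>}"
  proof -
    have "2 \<le> card (S - {{\<one>}})" using rk one_S finite_S by simp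
    then obtain T where T: "T \<subseteq> S - {{\<one>}}" "card T = 2" by (meson obtain_subset_with_card_n)
    then obtain A B where "T = {A, B}" "A \<noteq> B" by (auto simp: card_2_iff)
    then show thesis using T that[of A B] by blast
  qed
  have finS: "finite C" if "C \<in> S" for C using finite_subset[OF S_sub[OF that] fin] .
  \<comment> \<open>Two disjoint sets that avoid the identity cannot both take up half of the
    group.\<close>
  obtain W where W: "W \<in> S" "W \<noteq> {\<one>}" and small: "2 * card W < order G"
  proof -
    have "card A + card B = card (A \<union> B)"
      using AB S_eq finS by (intro card_Un_disjoint[symmetric]) blast+
    also have "\<dots> \<le> card (carrier G - {\<one>})"
      using AB S_sub S_one fin by (intro card_mono) blast+
    also have "\<dots> < order G"
      unfolding order_def by (rule card_Diff1_less) (use fin in auto)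
    finally have "card A + card B < order G" .
    then have "2 * card A < order G \<or> 2 * card B < order G" by linarith
    then show thesis using that AB by blast
  qed
  have "order G \<noteq> 1" using small S_ne[OF W(1)] finS[OF W(1)] by auto
  then obtain p where p: "Factorial_Ring.prime p" "p dvd order G" using prime_factor_nat by blast
  have p1: "1 < p" using prime_gt_1_nat[OF p(1)] .
  define P where "P = {z \<in> carrier G. z [^] p = \<one>}"
  have Pc: "P \<subseteq> carrier G" by (auto simp: P_def)
  have P_sub: "subgroup P G"
    unfolding P_def by (rule subgroup_torsion)
  obtain z where z: "z \<in> P" "z \<noteq> \<one>" using ex_torsion[OF p(2) p1] by (auto simp: P_def)
  have spread: "x \<otimes> z \<in> V" if V: "V \<in> S" "x \<in> V" "x \<notin> P" "z \<in> P" for V x z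
  proof -
    obtain E where E: "aset E" "\<And>y. y \<in> E \<Longrightarrow> y [^] (order G div p) = \<one>"
      "\<And>x z. \<lbrakk>x \<in> V; x [^] p \<notin> E; z \<in> carrier G; z [^] p = \<one>\<rbrakk> \<Longrightarrow> x \<otimes> z \<in> V"
      using frobenius_spread[OF aset_basic[OF V(1)] p] by blast
    \<comment> \<open>Otherwise \<open>E\<close> generates \<open>G\<close> by primitivity, although
      the exponent \<open>order G div p\<close> kills all of \<open>E\<close> but not
      \<open>g\<close>.\<close>
    have "E \<subseteq> {\<one>}"
    proof (rule ccontr)
      assume "\<not> E \<subseteq> {\<one>}"
      then have genE: "generate G E = carrier G" by (intro gen E) auto
      have incE: "generate G E \<subseteq> {y \<in> carrier G. y [^] (order G div p) = \<one>}"
      proof (rule generate_subgroup_incl)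
        show "E \<subseteq> {y \<in> carrier G. y [^] (order G div p) = \<one>}" using E aset_sub by blast
        show "subgroup {y \<in> carrier G. y [^] (order G div p) = \<one>} G"
          by (rule subgroup_torsion)
      qed
      have "g [^] (order G div p) = \<one>" using incE g_closed unfolding genE by blast
      then show False using pow_g_div_neq_one[OF p(2) p1] by simp
    qed
    moreover have "x \<in> carrier G" using V S_sub by blast
    ultimately have "x [^] p \<notin> E" using V by (auto simp: P_def)
    then show ?thesis using E(3)[of x z] V by (auto simp: P_def)
  qed
  \<comment> \<open>A basic set disjoint from \<open>P\<close> is invariant under \<open>z\<close>,
    so by primitivity its radical is \<open>G\<close>; then it contains
    \<open>v \<otimes> inv v\<close>.\<close>
  have meet: "V \<inter> P \<noteq> {}" if V: "V \<in> S" "V \<noteq> {\<one>}" for V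
  proof
    assume e: "V \<inter> P = {}"
    have "z \<in> rad V" using spread[OF V(1) _ _ z(1)] e z(1) Pc by (auto simp: rad_def)
    then have rad: "rad V = carrier G"
      using triv[OF a_subgroup_rad[OF aset_basic[OF V(1)]]] z(2) by blast
    obtain v where v: "v \<in> V" using S_ne[OF V(1)] by blast
    then have vc: "v \<in> carrier G" using S_sub[OF V(1)] by blast
    then have "inv v \<in> rad V" using rad by simp
    then have "v \<otimes> inv v \<in> V" using v unfolding rad_def by blast
    then have "\<one> \<in> V" using vc by simp
    then show False using S_one V by blast
  qed
  define a where "a = card (W - P)"
  have Wa: "aset W" and Wc: "W \<subseteq> carrier G" and Wf: "finite W"
    using aset_basic W S_sub finS by auto
  \<comment> \<open>The basic set of \<open>y\<close> contains some \<open>z\<close> in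
    \<open>P\<close>. Translation by \<open>z\<close> maps \<open>W - P\<close> into
    \<open>W\<close>, and \<open>y\<close> has the same count as \<open>z\<close>.\<close>
  have cnt: "a \<le> card {x \<in> W. x \<otimes> y \<in> W}" if y: "y \<in> carrier G - {\<one>}" for y
  proof -
    obtain V where V: "V \<in> S" "y \<in> V" using S_cover y by blast
    then have "V \<noteq> {\<one>}" using y by blast
    then obtain z where z: "z \<in> V" "z \<in> P" using meet V by blast
    have "W - P \<subseteq> {x \<in> W. x \<otimes> z \<in> W}" using spread[OF W(1)] z by blast
    then have "a \<le> card {x \<in> W. x \<otimes> z \<in> W}" unfolding a_def using Wf by (intro card_mono) auto
    then show ?thesis using count_const[OF Wa Wa V z(1)] by simp
  qed
  have "(\<Sum>y\<in>carrier G. card {x \<in> W. x \<otimes> y \<in> W}) = (\<Sum>x\<in>W. card {y \<in> carrier G. x \<otimes> y \<in> W})"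
    by (rule sum_card_swap[OF fin Wf])
  also have "\<dots> = card W * card W"
    using Wc card_translate[OF _ Wc] by (simp add: subset_iff)
  finally have "card W * card W = card {x \<in> W. x \<otimes> \<one> \<in> W}
      + (\<Sum>y\<in>carrier G - {\<one>}. card {x \<in> W. x \<otimes> y \<in> W})"
    using sum.remove[OF fin one_closed, of "\<lambda>y. card {x \<in> W. x \<otimes> y \<in> W}"] by simp
  moreover have "{x \<in> W. x \<otimes> \<one> \<in> W} = W" using Wc by auto
  moreover have "(\<Sum>y\<in>carrier G - {\<one>}. card {x \<in> W. x \<otimes> y \<in> W}) \<ge> card (carrier G - {\<one>}) * a"
    using sum_bounded_below[of "carrier G - {\<one>}" a] cnt by simp
  moreover have "card (carrier G - {\<one>}) = order G - 1" using fin by (simp add: order_def)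
  \<comment> \<open>The pairs of elements of \<open>W\<close> are sorted by their quotient: the
    identity accounts for \<open>card W\<close> of them, every other element for at least
    \<open>a\<close>.\<close>
  ultimately have main: "card W * card W \<ge> card W + (order G - 1) * a" by simp
  \<comment> \<open>Otherwise \<open>(order G - 1) * a\<close>, which is at least
    \<open>2 * card W * a\<close>, would already reach \<open>card W * card W\<close>.\<close>
  have "2 * a < card W"
  proof (rule ccontr)
    assume "\<not> 2 * a < card W"
    then have "2 * card W * a \<ge> card W * card W" by simp
    moreover have "2 * card W * a \<le> (order G - 1) * a" using small by (intro mult_right_mono) auto
    moreover have "0 < card W" using W S_ne Wf by (auto simp: card_gt_0_iff)
    ultimately show False using main by linarith
  qed
  moreover have "card W = a + card (W \<inter> P)"
    unfolding a_def using card_Diff_subset_Int[of W P] Wf card_mono[of W "W \<inter> P"] by simp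
  ultimately have "a < card (W \<inter> P)" by linarith
  also have "card (W \<inter> P) \<le> card P" using finite_subset[OF Pc fin] by (intro card_mono) auto
  finally have aP: "a < card P" .
  \<comment> \<open>A point of \<open>W\<close> outside \<open>P\<close> would bring its whole coset
    of \<open>P\<close> into \<open>W - P\<close>, which has only \<open>a < card P\<close>
    elements.\<close>
  have "W \<subseteq> P"
  proof (rule ccontr)
    assume "\<not> W \<subseteq> P"
    then obtain x where x: "x \<in> W" "x \<notin> P" by blast
    have xc: "x \<in> carrier G" using x Wc by blast
    have "(\<lambda>z. x \<otimes> z) ` P \<subseteq> W - P"
    proof clarify
      fix z assume z: "z \<in> P"
      have "x \<otimes> z \<notin> P"
      proof
        assume "x \<otimes> z \<in> P"
        then have "x \<otimes> z \<otimes> inv z \<in> P" using z P_sub by (simp add: subgroup.m_closed subgroup.m_inv_closed)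
        then show False using x xc z Pc by (simp add: m_assoc subset_iff)
      qed
      then show "x \<otimes> z \<in> W - P" using spread[OF W(1) x z] by blast
    qed
    then have "card ((\<lambda>z. x \<otimes> z) ` P) \<le> a" unfolding a_def using Wf by (intro card_mono) auto
    moreover have "card ((\<lambda>z. x \<otimes> z) ` P) = card P"
      using xc Pc by (intro card_image) (auto simp: inj_on_def subset_iff)
    ultimately show False using aP by simp
  qed
  then have "generate G W \<subseteq> P" using generate_subgroup_incl[OF _ P_sub] by blast
  then have "carrier G = P" using gen[OF Wa S_ne[OF W(1)] W(2)] Pc by blast
  then have "order G \<le> p" using card_torsion_le[of p] p1 by (simp add: order_def P_def)
  then have "order G = p" using p(2) order_pos by (simp add: dvd_imp_le le_antisym)
  then show ?thesis using p(1) by simp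
qed

section \<open>S-rings over groups of prime order\<close>

lemma prime_order_pow:
  assumes p: "Factorial_Ring.prime (order G)" and x: "x \<in> carrier G" "x \<noteq> \<one>"
  obtains i where "0 < i" "coprime i (order G)" "x = g [^] i"
proof -
  obtain i where i: "i < order G" "x = g [^] i" using ex_pow_less[OF x(1)] by blast
  have i0: "0 < i" using i x(2) by (cases i) auto
  then have "\<not> order G dvd i" using i(1) by (auto dest: dvd_imp_le)
  then have "coprime i (order G)" using prime_imp_coprime[OF p] coprime_commute by blast
  then show thesis using that i0 i(2) by blast
qed

lemma prime_order_pow_pow:
  assumes p: "Factorial_Ring.prime (order G)"
    and x: "x \<in> carrier G" "x \<noteq> \<one>" and y: "y \<in> carrier G" "y \<noteq> \<one>"
  obtains m where "0 < m" "coprime m (order G)" "y = x [^] m"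
proof -
  obtain i where i: "0 < i" "coprime i (order G)" "x = g [^] i" using prime_order_pow[OF p x] .
  obtain j where j: "0 < j" "coprime j (order G)" "y = g [^] j" using prime_order_pow[OF p y] .
  obtain q :: nat where q: "0 < q" "coprime q (order G)" "\<forall>x\<in>carrier G. (x [^] i) [^] q = x"
    using coprime_pow_inverse[OF i(2,1)] by blast
  have "x [^] q = g" using q(3) i(3) by simp
  then have "y = x [^] (q * j)" using j(3) nat_pow_pow[OF x(1), of q j] by simp
  then show thesis using that[of "q * j"] q(1,2) j(1,2) by simp
qed

lemma auto_pow:
  assumes p: "Factorial_Ring.prime (order G)" and f: "f \<in> auto G"
  obtains m where "0 < m" "coprime m (order G)" "\<forall>x\<in>carrier G. f x = x [^] m"
proof -
  have hom: "f \<in> hom G G" and bij: "bij_betw f (carrier G) (carrier G)"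
    using f by (auto simp: auto_def Bij_def)
  have f1: "f \<one> = \<one>" using hom_one[OF hom is_group is_group] .
  have "g \<noteq> \<one>"
    using pow_g_eq_one[of 1] prime_gt_1_nat[OF p] by auto
  then have "f g \<noteq> \<one>" using bij f1 by (metis bij_betw_def g_closed inj_onD one_closed)
  moreover have fg: "f g \<in> carrier G" using hom g_closed by (rule hom_in_carrier)
  ultimately obtain m where m: "0 < m" "coprime m (order G)" "f g = g [^] m"
    using prime_order_pow[OF p fg] by metis
  have "f x = x [^] m" if x: "x \<in> carrier G" for x
  proof -
    obtain i :: nat where i: "x = g [^] i" using cyc[OF x] by blast
    have "f (g [^] i) = f g [^] i" for i :: nat
      by (induction i) (simp_all add: f1 hom_mult[OF hom])
    then show ?thesis unfolding i m(3) by (simp add: nat_pow_pow mult.commute)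
  qed
  then show thesis using that m(1,2) by blast
qed

text \<open>The power map is restricted to the carrier because elements of \<open>auto G\<close> are
  extensional functions.\<close>

lemma pow_auto:
  assumes m: "coprime m (order G)" "0 < m"
  shows "(\<lambda>x\<in>carrier G. x [^] m) \<in> auto G"
proof -
  obtain q :: nat where q: "\<forall>x\<in>carrier G. (x [^] m) [^] q = x"
    using coprime_pow_inverse[OF m] by blast
  then have q': "\<forall>x\<in>carrier G. (x [^] q) [^] m = x" by (simp add: nat_pow_pow mult.commute)
  have "bij_betw (\<lambda>x. x [^] m) (carrier G) (carrier G)"
    by (rule bij_betw_byWitness[where f'="\<lambda>x. x [^] q"]) (use q q' in auto)
  then have "bij_betw (\<lambda>x\<in>carrier G. x [^] m) (carrier G) (carrier G)"
    using bij_betw_cong[of "carrier G" "\<lambda>x\<in>carrier G. x [^] m" "\<lambda>x. x [^] m"] by simp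
  moreover have "(\<lambda>x\<in>carrier G. x [^] m) \<in> hom G G"
    by (auto simp: hom_def pow_mult_distrib m_comm)
  ultimately show ?thesis by (auto simp: auto_def Bij_def)
qed

lemma mult_AutoGroup:
  assumes "f \<in> auto G" "h \<in> auto G"
  shows "f \<otimes>\<^bsub>AutoGroup G\<^esub> h = compose (carrier G) f h"
  using assms by (simp add: AutoGroup_def BijGroup_def auto_def)

lemma one_AutoGroup: "\<one>\<^bsub>AutoGroup G\<^esub> = (\<lambda>x\<in>carrier G. x)"
  by (simp add: AutoGroup_def BijGroup_def)

lemma carrier_AutoGroup: "carrier (AutoGroup G) = auto G"
  by (simp add: AutoGroup_def)

lemma image_compose_carrier: "B \<subseteq> carrier G \<Longrightarrow> compose (carrier G) f h ` B = f ` h ` B"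
  unfolding image_image by (intro image_cong) (auto simp: compose_def)

lemma subgroup_stabilizer:
  "subgroup {f \<in> auto G. \<forall>B\<in>S. f ` B = B} (AutoGroup G)" (is "subgroup ?K _")
proof -
  interpret A: group "AutoGroup G" by (rule AutoGroup)
  have id: "(\<lambda>x\<in>carrier G. x) ` B = B" if "B \<in> S" for B
  proof -
    have "(\<lambda>x\<in>carrier G. x) ` B = id ` B" using S_sub[OF that] by (intro image_cong) auto
    then show ?thesis by simp
  qed
  show ?thesis
  proof (rule A.subgroupI)
    show "?K \<subseteq> carrier (AutoGroup G)" by (auto simp: carrier_AutoGroup)
    show "?K \<noteq> {}" using id_in_auto id by blast
  next
    fix f assume f: "f \<in> ?K"
    let ?h = "inv\<^bsub>AutoGroup G\<^esub> f"
    have fc: "f \<in> carrier (AutoGroup G)" using f by (simp add: carrier_AutoGroup)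
    then have h: "?h \<in> auto G" using A.inv_closed[OF fc] by (simp add: carrier_AutoGroup)
    have "?h \<otimes>\<^bsub>AutoGroup G\<^esub> f = \<one>\<^bsub>AutoGroup G\<^esub>" using A.l_inv[OF fc] .
    then have c: "compose (carrier G) ?h f = (\<lambda>x\<in>carrier G. x)"
      using f h by (simp add: mult_AutoGroup one_AutoGroup)
    have "?h ` B = B" if B: "B \<in> S" for B
    proof -
      have "?h ` B = ?h ` f ` B" using f B by simp
      also have "\<dots> = B" using image_compose_carrier[OF S_sub[OF B], of ?h f] c id[OF B] by simp
      finally show ?thesis .
    qed
    then show "?h \<in> ?K" using h by blast
  next
    fix f h assume f: "f \<in> ?K" and h: "h \<in> ?K"
    have "f \<otimes>\<^bsub>AutoGroup G\<^esub> h \<in> auto G"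
      using A.m_closed[of f h] f h by (simp add: carrier_AutoGroup)
    moreover have "(f \<otimes>\<^bsub>AutoGroup G\<^esub> h) ` B = B" if B: "B \<in> S" for B
    proof -
      have "(f \<otimes>\<^bsub>AutoGroup G\<^esub> h) ` B = f ` h ` B"
        using f h mult_AutoGroup[of f h] image_compose_carrier[OF S_sub[OF B], of f h] by simp
      then show ?thesis using f h B by simp
    qed
    ultimately show "f \<otimes>\<^bsub>AutoGroup G\<^esub> h \<in> ?K" by blast
  qed
qed

text \<open>\<open>K\<close> consists of the automorphisms that fix every basic set. Automorphisms
  are power maps; these commute, permute the basic sets and are transitive on the nonidentity
  elements, which makes \<open>K\<close> transitive on each basic set. As \<open>K\<close> acts
  freely on nonidentity elements, each basic set other than \<open>{\<one>}\<close> has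
  \<open>card K\<close> elements, and the divisibility follows.\<close>

theorem prime_order_Cyc:
  assumes p: "Factorial_Ring.prime (order G)"
  shows "card S - 1 dvd order G - 1" and "is_Cyc G ((order G - 1) div (card S - 1)) S"
proof -
  define K where "K = {f \<in> auto G. \<forall>B\<in>S. f ` B = B}"
  have KB: "f x \<in> B" if "f \<in> K" "B \<in> S" "x \<in> B" for f x B
  proof -
    have "f ` B = B" using that by (simp add: K_def)
    from equalityD1[OF this] show ?thesis using that(3) by blast
  qed
  have K1: "(\<lambda>x\<in>carrier G. x) \<in> K"
    using subgroup.one_closed[OF subgroup_stabilizer] by (simp add: K_def one_AutoGroup)
  have pow_eq: "(\<lambda>x. x [^] m) ` B = C"
    if "coprime m (order G)" "0 < m" "B \<in> S" "C \<in> S" "x \<in> B" "x [^] m \<in> C" for m :: nat and x B C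
    using S_eq[OF basic_pow[OF that(1-3)] that(4) _ that(6)] that(5) by blast
  \<comment> \<open>An exponent \<open>m\<close> that keeps one nonidentity point in its basic set
    \<open>B\<close> fixes \<open>B\<close>. Any other nontrivial basic set is the image of
    \<open>B\<close> under some exponent \<open>k\<close>, and the two power maps commute.\<close>
  have KI: "(\<lambda>x\<in>carrier G. x [^] m) \<in> K"
    if m: "coprime m (order G)" "0 < m" and B: "B \<in> S" "x \<in> B" "x [^] m \<in> B" "x \<noteq> \<one>" for m :: nat and x B
  proof -
    have xc: "x \<in> carrier G" using S_sub B by blast
    have mB: "(\<lambda>x. x [^] m) ` B = B" using pow_eq[OF m B(1) B(1-3)] .
    have "(\<lambda>x. x [^] m) ` C = C" if C: "C \<in> S" for C
    proof (cases "C = {\<one>}")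
      case False
      obtain y where y: "y \<in> C" using S_ne[OF C] by blast
      then have yc: "y \<in> carrier G" and y1: "y \<noteq> \<one>" using S_sub[OF C] S_one[OF C] False by auto
      obtain k where k: "0 < k" "coprime k (order G)" "y = x [^] k"
        using prime_order_pow_pow[OF p xc B(4) yc y1] .
      have kB: "(\<lambda>x. x [^] k) ` B = C" using pow_eq[OF k(2,1) B(1) C B(2)] y k(3) by simp
      have "(\<lambda>x. x [^] m) ` C = (\<lambda>x. (x [^] k) [^] m) ` B" unfolding kB[symmetric] image_image ..
      also have "\<dots> = (\<lambda>x. (x [^] m) [^] k) ` B"
        using S_sub[OF B(1)] by (intro image_cong refl) (auto simp: nat_pow_pow mult.commute)
      also have "\<dots> = (\<lambda>x. x [^] k) ` (\<lambda>x. x [^] m) ` B" unfolding image_image ..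
      also have "\<dots> = C" unfolding mB kB ..
      finally show ?thesis .
    qed simp
    moreover have "(\<lambda>x\<in>carrier G. x [^] m) ` C = (\<lambda>x. x [^] m) ` C" if "C \<in> S" for C
      using S_sub[OF that] by (intro image_cong) auto
    ultimately show ?thesis using pow_auto[OF m] by (simp add: K_def)
  qed
  have orbit: "(\<lambda>f. f x) ` K = B" if B: "B \<in> S" "x \<in> B" for x B
  proof (intro equalityI subsetI)
    fix y assume "y \<in> (\<lambda>f. f x) ` K"
    then show "y \<in> B" using KB B by blast
  next
    fix y assume y: "y \<in> B"
    have xc: "x \<in> carrier G" and yc: "y \<in> carrier G" using S_sub B y by blast+
    show "y \<in> (\<lambda>f. f x) ` K"
    proof (cases "x = \<one>")
      case True
      then have "y = x" using S_one[OF B(1)] B y by blast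
      then have "y = (\<lambda>x\<in>carrier G. x) x" using xc by simp
      then show ?thesis using K1 by (rule image_eqI)
    next
      case False
      then have y1: "y \<noteq> \<one>" using S_one[OF B(1)] B y by blast
      obtain m where m: "0 < m" "coprime m (order G)" "y = x [^] m"
        using prime_order_pow_pow[OF p xc False yc y1] .
      have "(\<lambda>x\<in>carrier G. x [^] m) \<in> K" using KI[OF m(2,1) B] y m(3) False by simp
      moreover have "y = (\<lambda>x\<in>carrier G. x [^] m) x" using xc m(3) by simp
      ultimately show ?thesis by (intro image_eqI)
    qed
  qed
  have "S = {(\<lambda>f. f x) ` K | x. x \<in> carrier G}"
  proof (intro equalityI subsetI)
    fix B assume B: "B \<in> S"
    then obtain x where x: "x \<in> B" using S_ne by blast
    then have "x \<in> carrier G" using B S_sub by blast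
    then show "B \<in> {(\<lambda>f. f x) ` K | x. x \<in> carrier G}" using orbit[OF B x] by blast
  next
    fix B assume "B \<in> {(\<lambda>f. f x) ` K | x. x \<in> carrier G}"
    then obtain x where x: "x \<in> carrier G" "B = (\<lambda>f. f x) ` K" by blast
    then obtain C where "C \<in> S" "x \<in> C" using S_cover by blast
    then show "B \<in> S" using orbit x by simp
  qed
  have card_B: "card B = card K" if B: "B \<in> S - {{\<one>}}" for B
  proof -
    obtain x where x: "x \<in> B" using S_ne B by blast
    have xc: "x \<in> carrier G" and x1: "x \<noteq> \<one>" using S_sub S_one B x by blast+
    \<comment> \<open>An automorphism is determined by its value at one nonidentity
      \<open>x\<close>, because every \<open>y\<close> is a power of \<open>x\<close>.\<close>
    have "inj_on (\<lambda>f. f x) K"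
    proof (rule inj_onI)
      fix f h assume f: "f \<in> K" and h: "h \<in> K" and eq: "f x = h x"
      have fh: "f \<in> auto G" "h \<in> auto G" using f h by (simp_all add: K_def)
      obtain a where "0 < a" "coprime a (order G)" and a: "\<forall>x\<in>carrier G. f x = x [^] a"
        using auto_pow[OF p fh(1)] .
      obtain b where "0 < b" "coprime b (order G)" and b: "\<forall>x\<in>carrier G. h x = x [^] b"
        using auto_pow[OF p fh(2)] .
      have xab: "x [^] a = x [^] b" using eq a b xc by simp
      show "f = h"
      proof (rule extensionalityI)
        show "f \<in> extensional (carrier G)" "h \<in> extensional (carrier G)"
          using f h by (auto simp: K_def auto_def Bij_def)
        fix y assume y: "y \<in> carrier G"
        show "f y = h y"
        proof (cases "y = \<one>")
          case True
          then show ?thesis using a b by simp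
        next
          case False
          obtain m where "0 < m" "coprime m (order G)" and m: "y = x [^] m"
            using prime_order_pow_pow[OF p xc x1 y False] .
          have "y [^] a = (x [^] a) [^] m" using xc m by (simp add: nat_pow_pow mult.commute)
          also have "\<dots> = y [^] b" unfolding xab using xc m by (simp add: nat_pow_pow mult.commute)
          finally show ?thesis using a b y by simp
        qed
      qed
    qed
    then have "card ((\<lambda>f. f x) ` K) = card K" by (rule card_image)
    then show ?thesis using orbit[OF _ x] B by simp
  qed
  have "order G = card (\<Union>S)" using part by (simp add: partition_on_def order_def)
  also have "\<dots> = (\<Sum>B\<in>S. card B)"
    using part finite_subset[OF S_sub fin] by (intro card_Union_disjoint) (auto simp: partition_on_def disjoint_def pairwise_def disjnt_def)
  also have "\<dots> = 1 + (\<Sum>B\<in>S - {{\<one>}}. card B)"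
    using sum.remove[OF finite_S one_S, of card] by simp
  also have "(\<Sum>B\<in>S - {{\<one>}}. card B) = (card S - 1) * card K"
    using card_B finite_S one_S by simp
  finally have n: "order G - 1 = (card S - 1) * card K" by simp
  then show "card S - 1 dvd order G - 1" by simp
  have "1 < order G" using prime_gt_1_nat[OF p] .
  then have "0 < card S - 1" using n by (metis gr0I mult_0 zero_less_diff less_numeral_extra(3))
  then have "card K = (order G - 1) div (card S - 1)" using n by simp
  moreover have "subgroup K (AutoGroup G)" unfolding K_def by (rule subgroup_stabilizer)
  ultimately show "is_Cyc G ((order G - 1) div (card S - 1)) S"
    unfolding is_Cyc_def using \<open>S = _\<close> by blast
qed

section \<open>Restriction and quotient\<close>

lemma a_subgroupD:
  assumes "a_subgroup G S H"
  shows "subgroup H G" "aset H" "H \<subseteq> carrier G" "finite H" "\<one> \<in> H" "0 < card H"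
proof -
  show H: "subgroup H G" "aset H" using assms by (auto simp: a_subgroup_def)
  show "H \<subseteq> carrier G" using subgroup.subset[OF H(1)] .
  then show "finite H" using fin finite_subset by blast
  moreover show "\<one> \<in> H" using subgroup.one_closed[OF H(1)] .
  ultimately show "0 < card H" by (auto simp: card_gt_0_iff)
qed

text \<open>Group ring elements are functions on the whole type, so the S-ring over \<open>H\<close>
  sits inside \<open>sspan G S\<close> as the functions vanishing off \<open>H\<close>.\<close>

lemma sspan_restrict:
  assumes H: "a_subgroup G S H"
  shows "f \<in> sspan (G\<lparr>carrier := H\<rparr>) {B \<in> S. B \<subseteq> H} \<longleftrightarrow> f \<in> sspan G S \<and> (\<forall>x. x \<notin> H \<longrightarrow> f x = 0)"
proof
  assume f: "f \<in> sspan (G\<lparr>carrier := H\<rparr>) {B \<in> S. B \<subseteq> H}"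
  have 0: "f x = 0" if "x \<notin> H" for x using sspan_outside[OF f] that by simp
  have "f \<in> sspan G S"
  proof (rule sspanI)
    fix x assume "x \<notin> carrier G"
    then have "x \<notin> H" using a_subgroupD(3)[OF H] by blast
    then show "f x = 0" by (rule 0)
  next
    fix B x y assume B: "B \<in> S" "x \<in> B" "y \<in> B"
    show "f x = f y" using aset_cases[OF a_subgroupD(2)[OF H] B(1)]
    proof
      assume "B \<subseteq> H"
      then show ?thesis using sspan_constant[OF f _ B(2,3)] B(1) by simp
    next
      assume "B \<inter> H = {}"
      then have "x \<notin> H" "y \<notin> H" using B by auto
      from 0[OF this(1)] 0[OF this(2)] show ?thesis by simp
    qed
  qed
  then show "f \<in> sspan G S \<and> (\<forall>x. x \<notin> H \<longrightarrow> f x = 0)" using 0 by blast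
next
  assume f: "f \<in> sspan G S \<and> (\<forall>x. x \<notin> H \<longrightarrow> f x = 0)"
  show "f \<in> sspan (G\<lparr>carrier := H\<rparr>) {B \<in> S. B \<subseteq> H}"
  proof (rule sspanI)
    fix B x y assume "B \<in> {B \<in> S. B \<subseteq> H}" "x \<in> B" "y \<in> B"
    then show "f x = f y" using sspan_constant[of f G S B x y] f by blast
  qed (use f in simp)
qed

theorem sring_restrict:
  assumes H: "a_subgroup G S H"
  obtains h where "cyclic_sring (G\<lparr>carrier := H\<rparr>) {B \<in> S. B \<subseteq> H} h"
proof -
  let ?K = "G\<lparr>carrier := H\<rparr>"
  note Hs = a_subgroupD[OF H]
  interpret K: group ?K using subgroup.subgroup_is_group[OF Hs(1) is_group] .
  have "comm_group ?K"
    using Hs(3) by (intro K.group_comm_groupI) (auto intro: m_comm)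
  have n: "card (rcosets H) * card H = order G" using lagrange[OF Hs(1)] .
  \<comment> \<open>With \<open>m\<close> the index of \<open>H\<close>, the element
    \<open>g [^] m\<close> generates \<open>H\<close>; it is the generator handed to the
    locale.\<close>
  define m where "m = card (rcosets H)"
  have H_eq: "H = {x \<in> carrier G. x [^] card H = \<one>}" using subgroup_eq_torsion[OF Hs(1)] .
  have m1: "g [^] m \<in> H"
    by (subst H_eq) (simp add: nat_pow_pow pow_g_eq_one m_def n)
  have "\<exists>j::nat. x = (g [^] m) [^]\<^bsub>?K\<^esub> j" if x: "x \<in> H" for x
  proof -
    have xc: "x \<in> carrier G" using x Hs(3) by blast
    then obtain i :: nat where i: "x = g [^] i" using cyc by blast
    have "g [^] (i * card H) = \<one>" using subgroup_pow_card[OF Hs(1) x] i by (simp add: nat_pow_pow)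
    then have "m * card H dvd i * card H" using n by (simp add: pow_g_eq_one m_def)
    then have "m dvd i" using Hs(6) by simp
    then obtain j where "i = m * j" by blast
    then show ?thesis using i by (intro exI[of _ j]) (simp add: nat_pow_pow nat_pow_consistent[symmetric])
  qed
  moreover have "is_sring ?K {B \<in> S. B \<subseteq> H}"
    unfolding is_sring_def
  proof (intro conjI ballI)
    have "\<Union>{B \<in> S. B \<subseteq> H} = H"
    proof (intro equalityI subsetI)
      fix x assume x: "x \<in> H"
      then obtain B where B: "B \<in> S" "x \<in> B" using S_cover Hs(3) by blast
      then have "B \<subseteq> H" using aset_cases[OF Hs(2) B(1)] x by blast
      then show "x \<in> \<Union>{B \<in> S. B \<subseteq> H}" using B by blast
    qed blast
    then show "partition_on (carrier ?K) {B \<in> S. B \<subseteq> H}"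
      using part by (auto simp: partition_on_def disjoint_def)
    show "{\<one>\<^bsub>?K\<^esub>} \<in> {B \<in> S. B \<subseteq> H}" using one_S Hs(5) by simp
  next
    fix B assume "B \<in> {B \<in> S. B \<subseteq> H}"
    then have B: "B \<in> S" "B \<subseteq> H" by auto
    have "(\<lambda>x. inv\<^bsub>?K\<^esub> x) ` B = (\<lambda>x. inv x) ` B"
      using B m_inv_consistent[OF Hs(1)] by (intro image_cong) auto
    moreover have "(\<lambda>x. inv x) ` B \<subseteq> H" using B subgroup.m_inv_closed[OF Hs(1)] by blast
    ultimately show "(\<lambda>x. inv\<^bsub>?K\<^esub> x) ` B \<in> {B \<in> S. B \<subseteq> H}" using inv_S[OF B(1)] by simp
  next
    fix f h assume f: "f \<in> sspan ?K {B \<in> S. B \<subseteq> H}" and h: "h \<in> sspan ?K {B \<in> S. B \<subseteq> H}"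
    have f0: "f x = 0" and h0: "h x = 0" if "x \<notin> H" for x
      using f h that by (auto simp: sspan_restrict[OF H])
    have "conv ?K f h z = conv G f h z" for z
    proof (cases "z \<in> H")
      case True
      have "(\<Sum>x\<in>H. f x * h (inv\<^bsub>?K\<^esub> x \<otimes> z)) = (\<Sum>x\<in>H. f x * h (inv x \<otimes> z))"
        using m_inv_consistent[OF Hs(1)] by (intro sum.cong) auto
      also have "\<dots> = (\<Sum>x\<in>carrier G. f x * h (inv x \<otimes> z))"
        using fin Hs(3) f0 by (intro sum.mono_neutral_left) auto
      finally show ?thesis using True Hs(3) by (auto simp: conv_def)
    next
      case False
      have "f x * h (inv x \<otimes> z) = 0" if "x \<in> carrier G" "z \<in> carrier G" for x
      proof (cases "x \<in> H")
        case True
        have "inv x \<otimes> z \<notin> H"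
        proof
          assume "inv x \<otimes> z \<in> H"
          then have "x \<otimes> (inv x \<otimes> z) \<in> H" using True subgroup.m_closed[OF Hs(1)] by blast
          then show False using False that by (simp add: m_assoc[symmetric])
        qed
        then show ?thesis using h0 by simp
      qed (simp add: f0)
      then have "(\<Sum>x\<in>carrier G. f x * h (inv x \<otimes> z)) = 0" if "z \<in> carrier G"
        using that by (intro sum.neutral) blast
      then show ?thesis using False by (simp add: conv_def)
    qed
    then have "conv ?K f h = conv G f h" by blast
    moreover have "conv G f h \<in> sspan G S" using f h by (intro conv_sspan) (auto simp: sspan_restrict[OF H])
    moreover have "conv ?K f h z = 0" if "z \<notin> H" for z using that by (simp add: conv_def)
    ultimately show "conv ?K f h \<in> sspan ?K {B \<in> S. B \<subseteq> H}"
      by (simp add: sspan_restrict[OF H])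
  qed
  ultimately have "cyclic_sring ?K {B \<in> S. B \<subseteq> H} (g [^] m)"
    using \<open>comm_group ?K\<close> Hs(4) m1 by (simp add: cyclic_sring_def cyclic_sring_axioms_def)
  then show thesis using that by blast
qed

lemma a_subgroup_restrict:
  assumes H: "a_subgroup G S H" and N: "a_subgroup (G\<lparr>carrier := H\<rparr>) {B \<in> S. B \<subseteq> H} N"
  shows "a_subgroup G S N" "N \<subseteq> H"
proof -
  have sub: "subgroup N (G\<lparr>carrier := H\<rparr>)" using N by (simp add: a_subgroup_def)
  then show "N \<subseteq> H" using subgroup.subset by fastforce
  have "subgroup N G" using incl_subgroup[OF a_subgroupD(1)[OF H] sub] .
  then show "a_subgroup G S N" using N by (simp add: a_subgroup_def sspan_restrict[OF H])
qed

lemma coset_eq_iff: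
  assumes L: "subgroup L G" and x: "x \<in> carrier G" and y: "y \<in> carrier G"
  shows "L #> x = L #> y \<longleftrightarrow> (\<exists>l\<in>L. y = x \<otimes> l)"
proof
  assume "L #> x = L #> y"
  then have "y \<in> L #> x" using rcos_self[OF y L] by simp
  then obtain l where "l \<in> L" "y = l \<otimes> x" by (auto simp: r_coset_def)
  then show "\<exists>l\<in>L. y = x \<otimes> l" using x subgroup.mem_carrier[OF L] m_comm by blast
next
  assume "\<exists>l\<in>L. y = x \<otimes> l"
  then obtain l where l: "l \<in> L" "y = x \<otimes> l" by blast
  then have "y = l \<otimes> x" using x subgroup.mem_carrier[OF L] m_comm by simp
  then have "y \<in> L #> x" using l by (auto simp: r_coset_def)
  then show "L #> x = L #> y" by (rule repr_independence[OF _ x L])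
qed

section \<open>Quotient modulo \<open>L\<close> when the S-ring is a wreath product over
  \<open>L\<close>\<close>

context
  fixes L
  assumes L: "a_subgroup G S L"
    and inv: "\<And>B x l. \<lbrakk>B \<in> S; \<not> B \<subseteq> L; x \<in> B; l \<in> L\<rbrakk> \<Longrightarrow> x \<otimes> l \<in> B"
begin

abbreviation \<pi> :: "'a \<Rightarrow> 'a set" where "\<pi> x \<equiv> L #> x"

abbreviation SQ :: "'a set set set" where "SQ \<equiv> (\<lambda>B. \<pi> ` B) ` S"

lemma hom_\<pi>: "group_hom G (G Mod L) \<pi>"
proof -
  have nL: "L \<lhd> G" using subgroup_imp_normal[OF a_subgroupD(1)[OF L]] .
  show ?thesis
    using normal.factorgroup_is_group[OF nL] normal.r_coset_hom_Mod[OF nL] is_group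
    by (simp add: group_hom_def group_hom_axioms_def)
qed

lemma quotient_sspan_pullback:
  assumes F: "F \<in> sspan (G Mod L) SQ"
  shows "(\<lambda>x. if x \<in> carrier G then F (\<pi> x) else 0) \<in> sspan G S"
proof -
  have "F (\<pi> x) = F (\<pi> y)" if "B \<in> S" "x \<in> B" "y \<in> B" for x y B
  proof -
    have "\<pi> ` B \<in> SQ" using that(1) by (rule imageI)
    from sspan_constant[OF F this] show ?thesis using that(2,3) by blast
  qed
  note const = this
  show ?thesis
  proof (rule sspanI)
    fix B x y assume B: "B \<in> S" "x \<in> B" "y \<in> B"
    then have "x \<in> carrier G" "y \<in> carrier G" using S_sub by blast+
    then show "(if x \<in> carrier G then F (\<pi> x) else 0) = (if y \<in> carrier G then F (\<pi> y) else 0)"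
      using const[OF B] by simp
  qed simp
qed

text \<open>Basic sets inside \<open>L\<close> all collapse to \<open>{L}\<close> and the others are
  unions of cosets, so images that meet coincide.\<close>

lemma quotient_partition: "partition_on (carrier (G Mod L)) SQ"
proof -
  have "\<pi> ` B = \<pi> ` C"
    if BC: "B \<in> S" "C \<in> S" "x \<in> B" "y \<in> C" and eq: "\<pi> x = \<pi> y" for B C x y
  proof -
    have xc: "x \<in> carrier G" and yc: "y \<in> carrier G" using S_sub BC by blast+
    obtain l where l: "l \<in> L" "y = x \<otimes> l" using coset_eq_iff[OF a_subgroupD(1)[OF L] xc yc] eq by blast
    show ?thesis
    proof (cases "B \<subseteq> L")
      case True
      then have "y \<in> L" using l BC(3) subgroup.m_closed[OF a_subgroupD(1)[OF L]] by blast
      then have C: "C \<subseteq> L" using aset_cases[OF a_subgroupD(2)[OF L] BC(2)] BC(4) by blast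
      have "\<pi> ` D = {L}" if "D \<subseteq> L" "D \<noteq> {}" for D
        using that coset_join2[OF _ a_subgroupD(1)[OF L]] a_subgroupD(3)[OF L]
        by (intro equalityI subsetI) (auto simp: subset_iff)
      then show ?thesis using True C S_ne BC(1,2) by simp
    next
      case False
      then have "y \<in> B" using inv[OF BC(1) _ BC(3)] l by blast
      then show ?thesis using S_eq[OF BC(1,2) _ BC(4)] by simp
    qed
  qed
  note img_eq = this
  have "disjoint SQ"
    unfolding disjoint_def
  proof (intro ballI impI)
    fix c d assume "c \<in> SQ" "d \<in> SQ" "c \<noteq> d"
    then obtain B C where B: "B \<in> S" "c = \<pi> ` B" and C: "C \<in> S" "d = \<pi> ` C" by blast
    show "c \<inter> d = {}"
    proof (rule ccontr)
      assume "c \<inter> d \<noteq> {}"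
      then obtain x y where "x \<in> B" "y \<in> C" "\<pi> x = \<pi> y" using B(2) C(2) by auto
      then have "c = d" using img_eq B C by blast
      then show False using \<open>c \<noteq> d\<close> by simp
    qed
  qed
  moreover have "\<Union>SQ = \<pi> ` carrier G"
    using part by (auto simp: partition_on_def)
  moreover have "{} \<notin> SQ" using S_ne by blast
  ultimately show ?thesis by (simp add: partition_on_def carrier_FactGroup)
qed

text \<open>Every coset is hit by \<open>card L\<close> elements of \<open>G\<close>. The nonzero
  factor cancels afterwards, so closure under \<open>conv\<close> passes from \<open>G\<close> to
  the quotient.\<close>

lemma conv_pullback:
  assumes z: "z \<in> carrier G"
  shows "conv G (\<lambda>x. if x \<in> carrier G then F (\<pi> x) else 0) (\<lambda>x. if x \<in> carrier G then H (\<pi> x) else 0) z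
    = int (card L) * conv (G Mod L) F H (\<pi> z)"
proof -
  interpret h: group_hom G "G Mod L" \<pi> by (rule hom_\<pi>)
  let ?t = "\<lambda>c. F c * H (inv\<^bsub>G Mod L\<^esub> c \<otimes>\<^bsub>G Mod L\<^esub> \<pi> z)"
  have "conv G (\<lambda>x. if x \<in> carrier G then F (\<pi> x) else 0) (\<lambda>x. if x \<in> carrier G then H (\<pi> x) else 0) z
      = (\<Sum>x\<in>carrier G. ?t (\<pi> x))"
    using z by (auto simp: conv_def h.hom_mult h.hom_inv simp del: mult_FactGroup intro!: sum.cong)
  also have "\<dots> = (\<Sum>c\<in>\<pi> ` carrier G. \<Sum>x\<in>{x \<in> carrier G. \<pi> x = c}. ?t (\<pi> x))"
    by (rule sum.image_gen[OF fin])
  also have "\<dots> = (\<Sum>c\<in>\<pi> ` carrier G. int (card L) * ?t c)"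
  proof (rule sum.cong[OF refl])
    fix c assume "c \<in> \<pi> ` carrier G"
    then obtain y where y: "y \<in> carrier G" "c = \<pi> y" by blast
    have "{x \<in> carrier G. \<pi> x = c} = c"
    proof (intro equalityI subsetI)
      fix x assume "x \<in> {x \<in> carrier G. \<pi> x = c}"
      then show "x \<in> c" using rcos_self[OF _ a_subgroupD(1)[OF L]] by auto
    next
      fix x assume x: "x \<in> c"
      then have "x \<in> carrier G" using y r_coset_subset_G[OF a_subgroupD(3)[OF L]] by blast
      moreover have "\<pi> y = \<pi> x" using repr_independence[OF _ y(1) a_subgroupD(1)[OF L]] x y(2) by simp
      ultimately show "x \<in> {x \<in> carrier G. \<pi> x = c}" using y(2) by simp
    qed
    moreover have "card c = card L"
      using card_rcosets_equal[OF _ a_subgroupD(3)[OF L], of c] rcosetsI[OF a_subgroupD(3)[OF L] y(1)] y(2) by simp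
    ultimately have "card {x \<in> carrier G. \<pi> x = c} = card L" by simp
    then show "(\<Sum>x\<in>{x \<in> carrier G. \<pi> x = c}. ?t (\<pi> x)) = int (card L) * ?t c"
      by simp
  qed
  also have "\<dots> = int (card L) * conv (G Mod L) F H (\<pi> z)"
    using z by (auto simp: conv_def sum_distrib_left carrier_FactGroup simp del: mult_FactGroup)
  finally show ?thesis .
qed

theorem sring_quotient: "cyclic_sring (G Mod L) SQ (\<pi> g)"
proof -
  interpret h: group_hom G "G Mod L" \<pi> by (rule hom_\<pi>)
  have "comm_group (G Mod L)" using abelian_FactGroup[OF a_subgroupD(1)[OF L]] .
  moreover have "finite (carrier (G Mod L))" using fin by (simp add: carrier_FactGroup)
  moreover have "\<exists>i::nat. c = \<pi> g [^]\<^bsub>G Mod L\<^esub> i" if c: "c \<in> carrier (G Mod L)" for c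
  proof -
    obtain x where x: "x \<in> carrier G" "c = \<pi> x" using c by (auto simp: carrier_FactGroup)
    obtain i :: nat where "x = g [^] i" using cyc[OF x(1)] by blast
    then have "c = \<pi> g [^]\<^bsub>G Mod L\<^esub> i" using x(2) h.hom_nat_pow by simp
    then show ?thesis by blast
  qed
  moreover have "is_sring (G Mod L) SQ"
    unfolding is_sring_def
  proof (intro conjI ballI)
    show "partition_on (carrier (G Mod L)) SQ" by (rule quotient_partition)
    have "\<pi> ` {\<one>} \<in> SQ" using one_S by blast
    then show "{\<one>\<^bsub>G Mod L\<^esub>} \<in> SQ" using h.hom_one by simp
  next
    fix c assume "c \<in> SQ"
    then obtain B where B: "B \<in> S" "c = \<pi> ` B" by blast
    have "(\<lambda>x. inv\<^bsub>G Mod L\<^esub> x) ` c = \<pi> ` (\<lambda>x. inv x) ` B"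
      unfolding B(2) image_image using S_sub[OF B(1)] by (intro image_cong refl) (auto simp: h.hom_inv)
    then show "(\<lambda>x. inv\<^bsub>G Mod L\<^esub> x) ` c \<in> SQ" using inv_S[OF B(1)] by simp
  next
    fix F H assume F: "F \<in> sspan (G Mod L) SQ" and H: "H \<in> sspan (G Mod L) SQ"
    let ?f = "conv G (\<lambda>x. if x \<in> carrier G then F (\<pi> x) else 0) (\<lambda>x. if x \<in> carrier G then H (\<pi> x) else 0)"
    have f: "?f \<in> sspan G S" by (intro conv_sspan quotient_sspan_pullback F H)
    have "conv (G Mod L) F H (\<pi> x) = conv (G Mod L) F H (\<pi> y)"
      if "B \<in> S" "x \<in> B" "y \<in> B" for B x y
    proof -
      have "x \<in> carrier G" "y \<in> carrier G" using that S_sub by blast+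
      then have "int (card L) * conv (G Mod L) F H (\<pi> x) = int (card L) * conv (G Mod L) F H (\<pi> y)"
        using sspan_constant[OF f that] by (simp add: conv_pullback)
      then show ?thesis using a_subgroupD(6)[OF L] by simp
    qed
    note const = this
    show "conv (G Mod L) F H \<in> sspan (G Mod L) SQ"
    proof (rule sspanI)
      fix C c d assume "C \<in> SQ" "c \<in> C" "d \<in> C"
      then obtain B x y where B: "B \<in> S" "x \<in> B" "y \<in> B" and "c = \<pi> x" "d = \<pi> y" by blast
      then show "conv (G Mod L) F H c = conv (G Mod L) F H d" using const[OF B] by simp
    qed (simp add: conv_def)
  qed
  ultimately show ?thesis by (simp add: cyclic_sring_def cyclic_sring_axioms_def carrier_FactGroup)
qed

lemma a_subgroup_pullback:
  assumes M: "a_subgroup (G Mod L) SQ M"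
  shows "a_subgroup G S {x \<in> carrier G. \<pi> x \<in> M}"
proof -
  interpret h: group_hom G "G Mod L" \<pi> by (rule hom_\<pi>)
  have Ms: "subgroup M (G Mod L)" and MF: "indic M \<in> sspan (G Mod L) SQ"
    using M by (auto simp: a_subgroup_def)
  have "indic {x \<in> carrier G. \<pi> x \<in> M} = (\<lambda>x. if x \<in> carrier G then indic M (\<pi> x) else 0)"
    by (auto simp: indic_def)
  then have "aset {x \<in> carrier G. \<pi> x \<in> M}" using quotient_sspan_pullback[OF MF] by simp
  moreover have "subgroup {x \<in> carrier G. \<pi> x \<in> M} G"
  proof (rule subgroupI)
    have "\<pi> \<one> \<in> M" using h.hom_one subgroup.one_closed[OF Ms] by simp
    then show "{x \<in> carrier G. \<pi> x \<in> M} \<noteq> {}" by blast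
  next
    fix a assume "a \<in> {x \<in> carrier G. \<pi> x \<in> M}"
    then show "inv a \<in> {x \<in> carrier G. \<pi> x \<in> M}"
      using subgroup.m_inv_closed[OF Ms, of "\<pi> a"] by (simp add: h.hom_inv)
  next
    fix a b assume "a \<in> {x \<in> carrier G. \<pi> x \<in> M}" "b \<in> {x \<in> carrier G. \<pi> x \<in> M}"
    then show "a \<otimes> b \<in> {x \<in> carrier G. \<pi> x \<in> M}"
      using subgroup.m_closed[OF Ms, of "\<pi> a" "\<pi> b"] h.hom_mult[of a b] by simp
  qed auto
  ultimately show ?thesis by (simp add: a_subgroup_def)
qed

end

section \<open>A unique subgroup with mixed cosets\<close>

text \<open>Double count of the pairs of \<open>u\<close> in \<open>L\<close> and \<open>z\<close>
  in \<open>U - L\<close> with \<open>u \<otimes> z\<close> in \<open>V\<close>: each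
  \<open>z\<close> has \<open>a\<close> partners, and each \<open>u\<close> has
  \<open>card (V \<inter> U)\<close>, since translation by \<open>u\<close> preserves both
  \<open>U\<close> and \<open>L\<close>.\<close>

lemma card_eq_count_sum:
  assumes L: "a_subgroup G S L" and V: "V \<subseteq> carrier G" "V \<inter> L = {}"
    and cnt: "\<And>z. z \<in> carrier G - L \<Longrightarrow> card {u \<in> L. u \<otimes> z \<in> V} = a"
    and U: "subgroup U G" "L \<subseteq> U"
  shows "card (V \<inter> U) * card L = (card U - card L) * a"
proof -
  note Ls = a_subgroupD[OF L]
  have Uc: "U \<subseteq> carrier G" using subgroup.subset[OF U(1)] .
  then have finU: "finite U" using fin finite_subset by blast
  have "(\<Sum>z\<in>U - L. card {u \<in> L. u \<otimes> z \<in> V}) = (\<Sum>z\<in>U - L. a)"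
    using cnt Uc by (intro sum.cong) auto
  also have "\<dots> = (card U - card L) * a" using card_Diff_subset[OF Ls(4) U(2)] by simp
  finally have 1: "(\<Sum>z\<in>U - L. card {u \<in> L. u \<otimes> z \<in> V}) = (card U - card L) * a" .
  have "(\<Sum>z\<in>U - L. card {u \<in> L. u \<otimes> z \<in> V}) = (\<Sum>u\<in>L. card {z \<in> U - L. u \<otimes> z \<in> V})"
    using finU Ls(4) by (intro sum_card_swap) auto
  also have "\<dots> = (\<Sum>u\<in>L. card (V \<inter> U))"
  proof (rule sum.cong[OF refl])
    fix u assume u: "u \<in> L"
    then have uc: "u \<in> carrier G" and uU: "u \<in> U" using Ls(3) U(2) by blast+
    have "{z \<in> U - L. u \<otimes> z \<in> V} = {z \<in> carrier G. u \<otimes> z \<in> V \<inter> U}"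
    proof (intro equalityI subsetI)
      fix z assume "z \<in> {z \<in> U - L. u \<otimes> z \<in> V}"
      then show "z \<in> {z \<in> carrier G. u \<otimes> z \<in> V \<inter> U}"
        using Uc subgroup.m_closed[OF U(1) uU] by auto
    next
      fix z assume z: "z \<in> {z \<in> carrier G. u \<otimes> z \<in> V \<inter> U}"
      then have "inv u \<otimes> (u \<otimes> z) \<in> U"
        using subgroup.m_closed[OF U(1) subgroup.m_inv_closed[OF U(1) uU]] by blast
      then have "z \<in> U" using z uc by (simp add: m_assoc[symmetric])
      moreover have "z \<notin> L" using z subgroup.m_closed[OF Ls(1) u] V(2) by auto
      ultimately show "z \<in> {z \<in> U - L. u \<otimes> z \<in> V}" using z by simp
    qed
    then show "card {z \<in> U - L. u \<otimes> z \<in> V} = card (V \<inter> U)"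
      using card_translate[OF uc, of "V \<inter> U"] V(1) by (simp add: le_infI1)
  qed
  also have "\<dots> = card (V \<inter> U) * card L" by simp
  finally show ?thesis using 1 by simp
qed

text \<open>The first equation is \<open>card_eq_count_sum\<close> for the whole group. The last
  counts the pairs of \<open>x\<close> in \<open>V\<close> and \<open>z\<close> in \<open>L\<close>
  with \<open>x \<otimes> z\<close> in \<open>V\<close>: the identity contributes
  \<open>card V\<close>, each other \<open>z\<close> the same \<open>c\<close> because
  \<open>L - {\<one>}\<close> is a basic set, while each \<open>x\<close> has \<open>a\<close>
  partners.\<close>

lemma count_formula:
  assumes L: "a_subgroup G S L" and L1: "L - {\<one>} \<in> S"
    and V: "V \<in> S" "V \<inter> L = {}"
    and cnt: "\<And>z. z \<in> carrier G - L \<Longrightarrow> card {u \<in> L. u \<otimes> z \<in> V} = a"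
  obtains c where "card V = (card (rcosets L) - 1) * a"
    "\<And>z. z \<in> L - {\<one>} \<Longrightarrow> card {x \<in> V. x \<otimes> z \<in> V} = c"
    "card V + (card L - 1) * c = card V * a"
proof -
  note Ls = a_subgroupD[OF L]
  have Vc: "V \<subseteq> carrier G" using S_sub[OF V(1)] .
  then have finV: "finite V" using fin finite_subset by blast
  have "V \<inter> carrier G = V" using Vc by blast
  then have "card V * card L = (order G - card L) * a"
    using card_eq_count_sum[OF L Vc V(2) cnt subgroup_self Ls(3)] by (simp add: order_def)
  moreover have "order G = card (rcosets L) * card L" using lagrange[OF Ls(1)] by simp
  ultimately have "card V * card L = ((card (rcosets L) - 1) * a) * card L"
    by (simp add: algebra_simps)
  then have cV: "card V = (card (rcosets L) - 1) * a" using Ls(6) by simp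
  obtain w where w: "w \<in> L - {\<one>}" using S_ne[OF L1] by blast
  define c where "c = card {x \<in> V. x \<otimes> w \<in> V}"
  have Va: "aset V" using aset_basic[OF V(1)] .
  have c: "card {x \<in> V. x \<otimes> z \<in> V} = c" if "z \<in> L - {\<one>}" for z
    unfolding c_def by (rule count_const[OF Va Va L1 that w])
  have "(\<Sum>z\<in>L. card {x \<in> V. x \<otimes> z \<in> V}) = card {x \<in> V. x \<otimes> \<one> \<in> V} + (\<Sum>z\<in>L - {\<one>}. card {x \<in> V. x \<otimes> z \<in> V})"
    by (rule sum.remove[OF Ls(4,5)])
  also have "(\<Sum>z\<in>L - {\<one>}. card {x \<in> V. x \<otimes> z \<in> V}) = (card L - 1) * c"
    using c Ls(4,5) by simp
  also have "{x \<in> V. x \<otimes> \<one> \<in> V} = V" using Vc by auto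
  finally have "card V + (card L - 1) * c = (\<Sum>z\<in>L. card {x \<in> V. x \<otimes> z \<in> V})" by simp
  also have "\<dots> = (\<Sum>x\<in>V. card {z \<in> L. x \<otimes> z \<in> V})" by (rule sum_card_swap[OF Ls(4) finV])
  also have "\<dots> = (\<Sum>x\<in>V. a)"
  proof (rule sum.cong[OF refl])
    fix x assume x: "x \<in> V"
    then have xc: "x \<in> carrier G - L" using Vc V(2) by blast
    have "{z \<in> L. x \<otimes> z \<in> V} = {z \<in> L. z \<otimes> x \<in> V}"
      using xc Ls(3) m_comm[of x] by (intro Collect_cong conj_cong refl) (simp add: subset_iff)
    then show "card {z \<in> L. x \<otimes> z \<in> V} = a" using cnt[OF xc] by simp
  qed
  finally have "card V + (card L - 1) * c = card V * a" by simp
  then show thesis using that[OF cV] c by blast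
qed

text \<open>If \<open>V\<close> meets every coset outside \<open>L\<close> in \<open>a \<le> card L / 2\<close> elements and \<open>p\<close> divides \<open>card L\<close>,
  then \<open>V\<close> is invariant under the subgroup of order \<open>p\<close> outside \<open>U = {x. x [^] p \<in> L}\<close>. An element of
  that subgroup would occur too often as a quotient of \<open>V\<close> unless \<open>U = G\<close>.\<close>

lemma mixed_index_prime:
  assumes L: "nontriv_a_subgroup G S L" and uniq: "\<And>H. nontriv_a_subgroup G S H \<Longrightarrow> H = L"
    and L1: "L - {\<one>} \<in> S"
    and V: "V \<in> S" "V \<inter> L = {}"
    and cnt: "\<And>z. z \<in> carrier G - L \<Longrightarrow> card {u \<in> L. u \<otimes> z \<in> V} = a"
    and a: "0 < a" "2 * a \<le> card L"
    and p: "Factorial_Ring.prime p" "p dvd card L"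
  shows "card (rcosets L) = p"
proof -
  define m where "m = card (rcosets L)"
  define l where "l = card L"
  have La: "a_subgroup G S L" and Lne: "L \<noteq> {\<one>}" "L \<noteq> carrier G"
    using L by (auto simp: nontriv_a_subgroup_def)
  note Ls = a_subgroupD[OF La]
  have n: "m * l = order G" using lagrange[OF Ls(1)] by (simp add: m_def l_def)
  have m0: "0 < m" using n order_pos by (metis gr0I mult_0)
  have p1: "1 < p" using prime_gt_1_nat[OF p(1)] .
  have pn: "p dvd order G" using p(2) n by (metis dvd_mult l_def)
  have l2: "2 \<le> l" using a by (simp add: l_def)
  have Vc: "V \<subseteq> carrier G" using S_sub[OF V(1)] .
  then have finV: "finite V" using fin finite_subset by blast
  have mem_L: "x \<in> L \<longleftrightarrow> x [^] l = \<one>" if "x \<in> carrier G" for x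
    by (subst subgroup_eq_torsion[OF Ls(1)]) (simp add: that l_def)
  obtain E where E: "aset E" "\<And>y. y \<in> E \<Longrightarrow> y [^] (order G div p) = \<one>"
    "\<And>x z. \<lbrakk>x \<in> V; x [^] p \<notin> E; z \<in> carrier G; z [^] p = \<one>\<rbrakk> \<Longrightarrow> x \<otimes> z \<in> V"
    using frobenius_spread[OF aset_basic[OF V(1)] p(1) pn] by blast
  \<comment> \<open>A basic set in \<open>E\<close> with a point outside \<open>L\<close> generates
    a nontrivial A-subgroup, proper because \<open>order G div p\<close> kills \<open>E\<close>. By
    uniqueness it is \<open>L\<close>, a contradiction.\<close>
  have EL: "y \<in> L" if y: "y \<in> E" for y
  proof (rule ccontr)
    assume yL: "y \<notin> L"
    have yc: "y \<in> carrier G" using y aset_sub[OF E(1)] by blast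
    then obtain B where B: "B \<in> S" "y \<in> B" using S_cover by blast
    have BE: "B \<subseteq> E" using aset_cases[OF E(1) B(1)] B(2) y by blast
    have yg: "y \<in> generate G B" using B(2) by (rule generate.incl)
    have "generate G B \<subseteq> {y \<in> carrier G. y [^] (order G div p) = \<one>}"
    proof (rule generate_subgroup_incl)
      show "B \<subseteq> {y \<in> carrier G. y [^] (order G div p) = \<one>}" using BE E(2) aset_sub[OF E(1)] by blast
      show "subgroup {y \<in> carrier G. y [^] (order G div p) = \<one>} G"
        by (rule subgroup_torsion)
    qed
    moreover have "g [^] (order G div p) \<noteq> \<one>" by (rule pow_g_div_neq_one[OF pn p1])
    ultimately have "g \<notin> generate G B" by blast
    then have "generate G B \<noteq> carrier G" using g_closed by metis
    moreover have "generate G B \<noteq> {\<one>}" using yg yL Ls(5) by auto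
    ultimately have "nontriv_a_subgroup G S (generate G B)"
      using a_subgroup_generate[OF aset_basic[OF B(1)]] by (simp add: nontriv_a_subgroup_def)
    then have "generate G B = L" by (rule uniq)
    then show False using yg yL by simp
  qed
  have spread: "x \<otimes> z \<in> V" if "x \<in> V" "x [^] (p * l) \<noteq> \<one>" "z \<in> carrier G" "z [^] p = \<one>" for x z
  proof -
    have xc: "x \<in> carrier G" using that Vc by blast
    have "x [^] p \<notin> L" using that(2) xc mem_L[of "x [^] p"] by (simp add: nat_pow_pow)
    then show ?thesis using E(3)[OF that(1) _ that(3,4)] EL by blast
  qed
  obtain z where z: "z \<in> carrier G" "z \<noteq> \<one>" "z [^] p = \<one>" using ex_torsion[OF pn p1] by blast
  have zL: "z \<in> L"
  proof -
    obtain k where "l = p * k" using p(2) by (auto simp: l_def)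
    then have "z [^] l = (z [^] p) [^] k" using z(1) by (simp add: nat_pow_pow)
    then show ?thesis using z mem_L by simp
  qed
  \<comment> \<open>This is the set of \<open>x\<close> with \<open>x [^] p\<close> in
    \<open>L\<close>, written as torsion so that its size is bounded by
    \<open>p * l\<close>.\<close>
  define U where "U = {x \<in> carrier G. x [^] (p * l) = \<one>}"
  have U: "subgroup U G"
    unfolding U_def by (rule subgroup_torsion)
  have LU: "L \<subseteq> U"
  proof
    fix x assume x: "x \<in> L"
    then have xc: "x \<in> carrier G" using Ls(3) by blast
    have "x [^] (p * l) = (x [^] l) [^] p" using xc by (simp add: nat_pow_pow mult.commute)
    then show "x \<in> U" using xc x mem_L by (simp add: U_def)
  qed
  have cU: "card U \<le> p * l" unfolding U_def using p1 l2 by (intro card_torsion_le) simp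
  \<comment> \<open>Otherwise \<open>z\<close> stabilizes \<open>V\<close>, so the radical of
    \<open>V\<close> is \<open>L\<close> by uniqueness. Then \<open>V\<close> consists of full
    cosets and \<open>a = card L\<close>, against \<open>2 * a \<le> card L\<close>.\<close>
  have "V \<inter> U \<noteq> {}"
  proof
    assume e: "V \<inter> U = {}"
    have "z \<in> rad V"
    proof -
      have "x \<otimes> z \<in> V" if x: "x \<in> V" for x
      proof (rule spread[OF x _ z(1,3)])
        show "x [^] (p * l) \<noteq> \<one>" using x e Vc unfolding U_def by blast
      qed
      then show ?thesis using z(1) by (simp add: rad_def)
    qed
    then have rad1: "rad V \<noteq> {\<one>}" using z(2) by blast
    have V1: "\<one> \<notin> V" using V(2) Ls(5) by blast
    obtain v where v: "v \<in> V" using S_ne[OF V(1)] by blast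
    then have vc: "v \<in> carrier G" using Vc by blast
    have "inv v \<notin> rad V" using v vc V1 by (auto simp: rad_def intro!: bexI[of _ v])
    then have "rad V \<noteq> carrier G" using inv_closed[OF vc] by auto
    then have radL: "rad V = L"
      using uniq a_subgroup_rad[OF aset_basic[OF V(1)]] rad1 by (simp add: nontriv_a_subgroup_def)
    have "u \<otimes> v \<in> V" if u: "u \<in> L" for u
    proof -
      have "u \<in> rad V" using u radL by simp
      then have "v \<otimes> u \<in> V" "u \<in> carrier G" using v by (auto simp: rad_def)
      then show ?thesis using m_comm[OF vc] by simp
    qed
    then have "{u \<in> L. u \<otimes> v \<in> V} = L" by blast
    moreover have "v \<in> carrier G - L" using v Vc V(2) by blast
    ultimately have "card L = a" using cnt[of v] by simp
    then show False using a by simp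
  qed
  then obtain x where x: "x \<in> V" "x [^] (p * l) = \<one>" "x \<in> carrier G" by (auto simp: U_def)
  \<comment> \<open>The element \<open>x [^] l\<close> is not the identity because \<open>x\<close>
    is outside \<open>L\<close>, and its order divides both \<open>p\<close> and
    \<open>m\<close>.\<close>
  have pm: "p dvd m"
  proof (rule ccontr)
    assume "\<not> p dvd m"
    then have cop: "coprime p m" using p(1) by (simp add: prime_imp_coprime)
    have "(x [^] l) [^] p = \<one>" using x by (simp add: nat_pow_pow mult.commute)
    moreover have "(x [^] l) [^] m = \<one>"
      using pow_order_eq_1[OF x(3)] x(3) n by (simp add: nat_pow_pow mult.commute)
    ultimately have "ord (x [^] l) dvd p" "ord (x [^] l) dvd m" using x(3) by (simp_all add: pow_eq_id)
    then have "ord (x [^] l) = 1" using cop by (metis coprime_common_divisor_nat)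
    then have "x [^] l = \<one>" using pow_ord_eq_1[of "x [^] l"] x(3) by simp
    then show False using mem_L[OF x(3)] x(1) V(2) by blast
  qed
  obtain c where cV: "card V = (m - 1) * a"
    and c: "\<And>z. z \<in> L - {\<one>} \<Longrightarrow> card {x \<in> V. x \<otimes> z \<in> V} = c"
    and formula: "card V + (l - 1) * c = card V * a"
    using count_formula[OF La L1 V cnt] unfolding m_def l_def by metis
  have "card (V \<inter> U) * l = (card U - l) * a"
    using card_eq_count_sum[OF La Vc V(2) cnt U LU] by (simp add: l_def)
  also have "\<dots> \<le> (p * l - l) * a" using cU by (intro mult_right_mono diff_le_mono) auto
  also have "\<dots> = ((p - 1) * a) * l" by (simp add: algebra_simps)
  finally have VU: "card (V \<inter> U) \<le> (p - 1) * a" using l2 by simp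
  have "card V = card (V \<inter> U) + card (V - U)"
    using card_Un_disjoint[of "V \<inter> U" "V - U"] finV by (metis Diff_disjoint Int_Diff_Un Int_Diff_disjoint finite_Diff finite_Int)
  \<comment> \<open>Translation by \<open>z\<close> maps \<open>V - U\<close> into \<open>V\<close>,
    and \<open>z\<close> lies in \<open>L - {\<one>}\<close>, where the count is
    \<open>c\<close>.\<close>
  moreover have "card (V - U) \<le> c"
  proof -
    have "x \<otimes> z \<in> V" if x: "x \<in> V - U" for x
    proof (rule spread[OF _ _ z(1,3)])
      show "x \<in> V" "x [^] (p * l) \<noteq> \<one>" using x Vc unfolding U_def by blast+
    qed
    then have "V - U \<subseteq> {x \<in> V. x \<otimes> z \<in> V}" by blast
    then have "card (V - U) \<le> card {x \<in> V. x \<otimes> z \<in> V}" using finV by (intro card_mono) auto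
    then show ?thesis using c[of z] zL z(2) by simp
  qed
  ultimately have low: "(m - 1) * a \<le> (p - 1) * a + c" using VU cV by linarith
  \<comment> \<open>If \<open>2 * p \<le> m\<close>, then \<open>low\<close> gives
    \<open>2 * c \<ge> m * a\<close>. Inserted into \<open>formula\<close> this yields
    \<open>(l - 1) * m * a \<le> (m - 1) * a * (2 * a - 2)\<close>, impossible because
    \<open>2 * a \<le> l\<close>. Since \<open>p\<close> divides \<open>m\<close>, only
    \<open>m = p\<close> survives.\<close>
  have "m < 2 * p"
  proof (rule ccontr)
    assume "\<not> m < 2 * p"
    then have m2p: "2 * p \<le> m" by simp
    have "int m - 1 = int (m - 1)" "int p - 1 = int (p - 1)" "int l - 1 = int (l - 1)"
      using m0 p1 l2 by auto
    then have low': "(int m - 1) * int a \<le> (int p - 1) * int a + int c"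
      and form': "(int m - 1) * int a + (int l - 1) * int c = (int m - 1) * int a * int a"
      using low formula[unfolded cV] by (metis of_nat_add of_nat_le_iff of_nat_mult)+
    have "int c \<ge> (int m - int p) * int a" using low' by (simp add: algebra_simps)
    moreover have "2 * ((int m - int p) * int a) \<ge> int m * int a"
    proof -
      have "int a * (2 * int p) \<le> int a * int m" using m2p by (intro mult_left_mono) auto
      then show ?thesis by (simp add: algebra_simps)
    qed
    ultimately have "2 * int c \<ge> int m * int a" by linarith
    then have "(int l - 1) * (int m * int a) \<le> (int l - 1) * (2 * int c)"
      using l2 by (intro mult_left_mono) auto
    also have "\<dots> = (int m - 1) * int a * (2 * int a - 2)" using form' by (simp add: algebra_simps)
    also have "\<dots> \<le> (int m - 1) * int a * (int l - 2)"
      using a m0 by (intro mult_left_mono) (auto simp: l_def)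
    also have "\<dots> < int m * int a * (int l - 1)"
    proof -
      have "(int m - 1) * int a * (int l - 2) \<le> int m * int a * (int l - 2)"
        using l2 by (intro mult_right_mono) auto
      also have "\<dots> < int m * int a * (int l - 1)"
        using a m0 by (intro mult_strict_left_mono) auto
      finally show ?thesis .
    qed
    finally show False by (simp add: algebra_simps)
  qed
  moreover obtain k where "m = p * k" using pm by blast
  ultimately have "k < 2" "0 < k" using m0 by auto
  then have "m = p" using \<open>m = p * k\<close> by (simp add: less_2_cases_iff)
  then show ?thesis by (simp add: m_def)
qed

text \<open>By \<open>count_const\<close> the number depends only on the basic set of
  \<open>z\<close>, so there is one value for \<open>W\<close> and one for \<open>Y\<close>. The
  coset of \<open>x\<close> contains points of both sets, and therefore the two values
  agree.\<close>

lemma coset_count_const: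
  assumes L: "a_subgroup G S L" and WY: "W \<in> S" "Y \<in> S" "W \<union> Y = carrier G - L"
    and x: "x \<in> W" "u \<in> L" "x \<otimes> u \<in> Y" and V: "V \<in> S"
    and z: "z \<in> carrier G - L"
  shows "card {u \<in> L. u \<otimes> z \<in> V} = card {u \<in> L. u \<otimes> x \<in> V}"
proof -
  note Ls = a_subgroupD[OF L]
  have xc: "x \<in> carrier G" and uc: "u \<in> carrier G" using x S_sub[OF WY(1)] Ls(3) by blast+
  have Va: "aset V" using aset_basic[OF V] .
  have shift: "card {v \<in> L. v \<otimes> (x \<otimes> u) \<in> V} = card {v \<in> L. v \<otimes> x \<in> V}"
  proof (rule bij_betw_same_card[where f="\<lambda>v. v \<otimes> u"])
    show "bij_betw (\<lambda>v. v \<otimes> u) {v \<in> L. v \<otimes> (x \<otimes> u) \<in> V} {v \<in> L. v \<otimes> x \<in> V}"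
    proof (rule bij_betw_byWitness[where f'="\<lambda>v. v \<otimes> inv u"])
      show "\<forall>v\<in>{v \<in> L. v \<otimes> (x \<otimes> u) \<in> V}. v \<otimes> u \<otimes> inv u = v"
        using uc Ls(3) by (auto simp: m_assoc subset_iff)
      show "\<forall>v\<in>{v \<in> L. v \<otimes> x \<in> V}. v \<otimes> inv u \<otimes> u = v"
        using uc Ls(3) by (auto simp: m_assoc subset_iff)
      show "(\<lambda>v. v \<otimes> u) ` {v \<in> L. v \<otimes> (x \<otimes> u) \<in> V} \<subseteq> {v \<in> L. v \<otimes> x \<in> V}"
      proof clarify
        fix v assume v: "v \<in> L" "v \<otimes> (x \<otimes> u) \<in> V"
        have "v \<otimes> u \<otimes> x = v \<otimes> (x \<otimes> u)" using v(1) uc xc Ls(3) m_comm[OF xc uc] by (simp add: m_assoc subset_iff)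
        then show "v \<otimes> u \<in> L \<and> v \<otimes> u \<otimes> x \<in> V" using v subgroup.m_closed[OF Ls(1) v(1) x(2)] by simp
      qed
      show "(\<lambda>v. v \<otimes> inv u) ` {v \<in> L. v \<otimes> x \<in> V} \<subseteq> {v \<in> L. v \<otimes> (x \<otimes> u) \<in> V}"
      proof clarify
        fix v assume v: "v \<in> L" "v \<otimes> x \<in> V"
        have vc: "v \<in> carrier G" using v(1) Ls(3) by blast
        have "v \<otimes> inv u \<otimes> (x \<otimes> u) = v \<otimes> (inv u \<otimes> (u \<otimes> x))"
          using m_comm[OF xc uc] vc uc xc by (simp add: m_assoc)
        also have "\<dots> = v \<otimes> x" using uc xc by (simp add: m_assoc[symmetric])
        finally show "v \<otimes> inv u \<in> L \<and> v \<otimes> inv u \<otimes> (x \<otimes> u) \<in> V"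
          using v subgroup.m_closed[OF Ls(1) v(1) subgroup.m_inv_closed[OF Ls(1) x(2)]] by simp
      qed
    qed
  qed
  have "z \<in> W \<or> z \<in> Y" using z WY(3) by blast
  then show ?thesis
  proof
    assume "z \<in> W"
    then show ?thesis using count_const[OF Ls(2) Va WY(1) _ x(1)] by blast
  next
    assume "z \<in> Y"
    then show ?thesis using count_const[OF Ls(2) Va WY(2) _ x(3)] shift by simp
  qed
qed

theorem mixed_order_four:
  assumes L: "nontriv_a_subgroup G S L" and uniq: "\<And>H. nontriv_a_subgroup G S H \<Longrightarrow> H = L"
    and L1: "L - {\<one>} \<in> S"
    and WY: "W \<in> S" "Y \<in> S" "W \<noteq> Y" "W \<union> Y = carrier G - L"
    and mixed: "x \<in> W" "u \<in> L" "x \<otimes> u \<in> Y"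
  shows "order G = 4"
proof -
  have La: "a_subgroup G S L" and Lne: "L \<noteq> {\<one>}" "L \<noteq> carrier G"
    using L by (auto simp: nontriv_a_subgroup_def)
  note Ls = a_subgroupD[OF La]
  define l where "l = card L"
  define m where "m = card (rcosets L)"
  have n: "m * l = order G" using lagrange[OF Ls(1)] by (simp add: m_def l_def)
  define a where "a = card {u \<in> L. u \<otimes> x \<in> W}"
  define b where "b = card {u \<in> L. u \<otimes> x \<in> Y}"
  have cntW: "card {u \<in> L. u \<otimes> z \<in> W} = a" if "z \<in> carrier G - L" for z
    unfolding a_def by (rule coset_count_const[OF La WY(1,2,4) mixed WY(1) that])
  have cntY: "card {u \<in> L. u \<otimes> z \<in> Y} = b" if "z \<in> carrier G - L" for z
    unfolding b_def by (rule coset_count_const[OF La WY(1,2,4) mixed WY(2) that])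
  have xc: "x \<in> carrier G - L" using mixed(1) WY(4) by blast
  have disj: "W \<inter> Y = {}" using S_eq[OF WY(1,2)] WY(3) by blast
  have WL: "W \<inter> L = {}" and YL: "Y \<inter> L = {}" using WY(4) by blast+
  have fin_sub: "finite {u \<in> L. u \<otimes> x \<in> V}" for V using Ls(4) by simp
  have un: "{u \<in> L. u \<otimes> x \<in> W} \<union> {u \<in> L. u \<otimes> x \<in> Y} = L"
  proof -
    have "v \<otimes> x \<in> W \<union> Y" if v: "v \<in> L" for v
    proof -
      have vc: "v \<in> carrier G" using v Ls(3) by blast
      have "v \<otimes> x \<notin> L"
      proof
        assume "v \<otimes> x \<in> L"
        then have "inv v \<otimes> (v \<otimes> x) \<in> L"
          using subgroup.m_closed[OF Ls(1) subgroup.m_inv_closed[OF Ls(1) v]] by blast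
        then show False using xc vc by (simp add: m_assoc[symmetric])
      qed
      then show ?thesis unfolding WY(4) using vc xc by simp
    qed
    then show ?thesis by blast
  qed
  have "{u \<in> L. u \<otimes> x \<in> W} \<inter> {u \<in> L. u \<otimes> x \<in> Y} = {}" using disj by blast
  from card_Un_disjoint[OF fin_sub fin_sub this] have ab: "a + b = l"
    unfolding a_def b_def l_def un by simp
  have "\<one> \<in> {u \<in> L. u \<otimes> x \<in> W}" using mixed(1) Ls(5) xc by simp
  then have a0: "0 < a" unfolding a_def using fin_sub by (auto simp: card_gt_0_iff)
  have "u \<in> {u \<in> L. u \<otimes> x \<in> Y}" using mixed xc Ls(3) by (auto simp: m_comm)
  then have b0: "0 < b" unfolding b_def using fin_sub by (auto simp: card_gt_0_iff)
  \<comment> \<open>As \<open>a + b = l\<close>, one of the two is at most half of \<open>l\<close>,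
    and \<open>mixed_index_prime\<close> applies to the corresponding basic set. It does so for
    every prime divisor of \<open>l\<close>, so there is only one.\<close>
  have index: "m = p" if p: "Factorial_Ring.prime p" "p dvd l" for p
  proof (cases "2 * a \<le> l")
    case True
    then show ?thesis unfolding m_def l_def
      using mixed_index_prime[OF L uniq L1 WY(1) WL cntW a0 _ p(1)] p(2) l_def by simp
  next
    case False
    then have "2 * b \<le> l" using ab by linarith
    then show ?thesis unfolding m_def l_def
      using mixed_index_prime[OF L uniq L1 WY(2) YL cntY b0 _ p(1)] p(2) l_def by simp
  qed
  have "l \<noteq> 1" using ab a0 b0 by linarith
  then obtain p where p: "Factorial_Ring.prime p" "p dvd l" using prime_factor_nat by blast
  have mp: "m = p" using index[OF p] .
  have prime_div: "q = p" if q: "Factorial_Ring.prime q" "q dvd order G" for q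
  proof -
    have "q dvd m \<or> q dvd l" using q n by (metis prime_dvd_mult_iff)
    then show ?thesis using index[OF q(1)] mp p(1) q(1) primes_dvd_imp_eq by blast
  qed
  have gL: "g \<notin> L"
  proof
    assume "g \<in> L"
    then have "generate G {g} \<subseteq> L" using generate_subgroup_incl[OF _ Ls(1)] by blast
    then have "carrier G \<subseteq> L" unfolding generate_g .
    with Ls(3) have "L = carrier G" by (rule equalityI)
    then show False using Lne(2) by simp
  qed
  \<comment> \<open>Since \<open>order G = p * l\<close>, an exponent divisible by \<open>p\<close>
    gives an element killed by \<open>l\<close>, hence an element of \<open>L\<close>; and
    \<open>p\<close> is the only prime divisor of the order.\<close>
  have cop: "\<exists>i. 0 < i \<and> coprime i (order G) \<and> y = g [^] i" if y: "y \<in> carrier G - L" for y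
  proof -
    obtain i :: nat where i: "y = g [^] i" using cyc[of y] y by blast
    have "\<not> p dvd i"
    proof
      assume "p dvd i"
      then obtain k where "i = p * k" by blast
      then have "order G dvd i * l" using n mp by (simp add: mult.commute mult.left_commute)
      then have "y [^] l = \<one>" using i pow_g_eq_one by (simp add: nat_pow_pow)
      then have "y \<in> L" by (subst subgroup_eq_torsion[OF Ls(1)]) (use y in \<open>simp add: l_def\<close>)
      then show False using y by blast
    qed
    then have "0 < i" by (cases i) auto
    moreover have "coprime i (order G)"
    proof (rule ccontr)
      assume "\<not> coprime i (order G)"
      then have "gcd i (order G) \<noteq> 1" by (simp add: coprime_iff_gcd_eq_1)
      then obtain q where "Factorial_Ring.prime q" "q dvd gcd i (order G)" using prime_factor_nat by blast
      then show False using prime_div[of q] \<open>\<not> p dvd i\<close> by auto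
    qed
    ultimately show ?thesis using i by blast
  qed
  \<comment> \<open>By \<open>cop\<close> a power map with invertible exponent takes
    \<open>g\<close> into \<open>C\<close>, so it maps \<open>B\<close> bijectively onto
    \<open>C\<close>.\<close>
  have card_eq: "card C = card B" if B: "B \<in> S" "C \<in> S" "g \<in> B" "C \<subseteq> carrier G - L" for B C
  proof -
    obtain y where y: "y \<in> C" using S_ne[OF B(2)] by blast
    then obtain i where i: "0 < i" "coprime i (order G)" "y = g [^] i" using cop B(4) by blast
    have eq: "(\<lambda>x. x [^] i) ` B = C"
      using S_eq[OF basic_pow[OF i(2,1) B(1)] B(2) _ y] i(3) B(3) by blast
    obtain q :: nat where q: "\<forall>x\<in>carrier G. (x [^] i) [^] q = x"
      using coprime_pow_inverse[OF i(2,1)] by blast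
    have "inj_on (\<lambda>x. x [^] i) B"
      by (rule inj_on_inverseI[of _ "\<lambda>x. x [^] q"]) (use q S_sub[OF B(1)] in blast)
    then show ?thesis using card_image eq by blast
  qed
  have "g \<in> W \<or> g \<in> Y" using gL WY(4) g_closed by blast
  then have WYc: "card W = card Y"
    using card_eq[OF WY(1,2)] card_eq[OF WY(2,1)] WY(4) by (metis Un_upper1 Un_upper2)
  obtain c where c: "card W = (m - 1) * a" "card W + (l - 1) * c = card W * a"
    using count_formula[OF La L1 WY(1) WL cntW] unfolding m_def l_def by metis
  obtain c' where c': "card Y = (m - 1) * b"
    using count_formula[OF La L1 WY(2) YL cntY] unfolding m_def l_def by metis
  have "1 < m" using mp prime_gt_1_nat[OF p(1)] by simp
  then have "a = b" using WYc c(1) c' by simp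
  then have l2a: "l = 2 * a" using ab by simp
  \<comment> \<open>Now \<open>l\<close> is even, so \<open>index\<close> applies to the prime 2.
    With \<open>m = 2\<close> the set \<open>W\<close> has just \<open>a\<close> elements, and the
    quotient count becomes an equation in \<open>a\<close> and \<open>c\<close> alone.\<close>
  then have m2: "m = 2" using index[of 2] two_is_prime_nat by simp
  then have "a + (2 * a - 1) * c = a * a" using c l2a by simp
  then have "(2 * a - 1) * c = a * (a - 1)" using a0 by (simp add: right_diff_distrib')
  then have "a = 1" using consecutive_product_odd_divisor a0 by blast
  then show ?thesis using n m2 l2a by simp
qed

lemma singletons_of_card:
  assumes "card S = order G"
  shows "S = {{x} | x. x \<in> carrier G}"
proof -
  have eq: "{{x} | x. x \<in> carrier G} = (\<lambda>x. {x}) ` carrier G" by blast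
  have ex: "\<exists>x. B = {x}" if B: "B \<in> S" for B
  proof (rule ccontr)
    assume neg: "\<nexists>x. B = {x}"
    have finB: "finite C" if "C \<in> S" for C using finite_subset[OF S_sub[OF that] fin] .
    have pos: "1 \<le> card C" if "C \<in> S" for C using S_ne[OF that] finB[OF that] by (simp add: Suc_le_eq card_gt_0_iff)
    have "card B \<noteq> 1" using neg by (auto simp: card_1_singleton_iff)
    then have "1 < card B" using pos[OF B] by simp
    then have "(\<Sum>C\<in>S. 1) < (\<Sum>C\<in>S. card C)"
      using pos B finite_S by (intro sum_strict_mono_ex1) auto
    also have "\<dots> = card (\<Union>S)"
      using part finB by (intro card_Union_disjoint[symmetric]) (auto simp: partition_on_def disjoint_def pairwise_def disjnt_def)
    also have "\<dots> = order G" using part by (simp add: partition_on_def order_def)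
    finally show False using assms by simp
  qed
  show ?thesis unfolding eq
  proof (intro equalityI subsetI)
    fix B assume B: "B \<in> S"
    then obtain x where "B = {x}" using ex by blast
    then show "B \<in> (\<lambda>x. {x}) ` carrier G" using S_sub[OF B] by blast
  next
    fix B assume "B \<in> (\<lambda>x. {x}) ` carrier G"
    then obtain x where x: "x \<in> carrier G" "B = {x}" by blast
    then obtain C where C: "C \<in> S" "x \<in> C" using S_cover by blast
    then obtain y where "C = {y}" using ex by blast
    then show "B \<in> S" using C x by simp
  qed
qed

section \<open>S-rings of rank 4\<close>

text \<open>Every block contains a basic set; as the numbers agree, this choice exhausts
  \<open>S\<close>. A point of a block then lies in the basic set chosen for some block, which can
  only be its own. So a rank 4 S-ring is known once four disjoint nonempty A-sets covering
  \<open>G\<close> are found.\<close>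

lemma asets_partition_eq:
  assumes T: "partition_on (carrier G) \<T>" and a: "\<And>T. T \<in> \<T> \<Longrightarrow> aset T" and card: "card \<T> = card S"
  shows "S = \<T>"
proof -
  have "\<exists>B\<in>S. B \<subseteq> T" if "T \<in> \<T>" for T
  proof -
    have "T \<noteq> {}" using T \<open>T \<in> \<T>\<close> by (auto simp: partition_on_def)
    then obtain x where x: "x \<in> T" by blast
    then have "x \<in> carrier G" using aset_sub[OF a[OF \<open>T \<in> \<T>\<close>]] by blast
    then obtain B where B: "B \<in> S" "x \<in> B" using S_cover by blast
    then have "B \<subseteq> T" using aset_cases[OF a[OF \<open>T \<in> \<T>\<close>] B(1)] x by blast
    then show ?thesis using B by blast
  qed
  then obtain \<phi> where \<phi>: "\<And>T. T \<in> \<T> \<Longrightarrow> \<phi> T \<in> S" "\<And>T. T \<in> \<T> \<Longrightarrow> \<phi> T \<subseteq> T" by metis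
  have T_eq: "T = U" if "T \<in> \<T>" "U \<in> \<T>" "x \<in> T" "x \<in> U" for T U x
    using T that unfolding partition_on_def disjoint_def by blast
  have "inj_on \<phi> \<T>"
  proof (rule inj_onI)
    fix T U assume TU: "T \<in> \<T>" "U \<in> \<T>" "\<phi> T = \<phi> U"
    obtain x where "x \<in> \<phi> T" using S_ne[OF \<phi>(1)[OF TU(1)]] by blast
    then have "x \<in> T" "x \<in> U" using \<phi>(2) TU by auto
    then show "T = U" using T_eq TU by blast
  qed
  then have "card (\<phi> ` \<T>) = card S" using card by (simp add: card_image)
  then have im: "\<phi> ` \<T> = S" using \<phi>(1) finite_S by (intro card_subset_eq) auto
  have "\<phi> T = T" if TT: "T \<in> \<T>" for T
  proof
    show "\<phi> T \<subseteq> T" using \<phi>(2)[OF TT] .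
    show "T \<subseteq> \<phi> T"
    proof
      fix x assume x: "x \<in> T"
      then have "x \<in> carrier G" using aset_sub[OF a[OF TT]] by blast
      then obtain B where B: "B \<in> S" "x \<in> B" using S_cover by blast
      then have "B \<in> \<phi> ` \<T>" using im by simp
      then obtain U where U: "U \<in> \<T>" "B = \<phi> U" by blast
      then have "x \<in> U" using \<phi>(2) B(2) by blast
      then have "U = T" using T_eq[OF U(1) TT] x by blast
      then show "x \<in> \<phi> T" using U B by simp
    qed
  qed
  then have "\<phi> ` \<T> = id ` \<T>" by (intro image_cong) auto
  then show ?thesis using im by simp
qed

lemma a_subgroup_card_two:
  assumes H: "a_subgroup G S H" and c: "card {B \<in> S. B \<subseteq> H} = 2"
  shows "H - {\<one>} \<in> S"
proof -
  let ?T = "{B \<in> S. B \<subseteq> H}"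
  note Hs = a_subgroupD[OF H]
  have "{\<one>} \<in> ?T" using one_S Hs(5) by simp
  moreover have "card (?T - {{\<one>}}) = 1" using c calculation finite_S by simp
  then obtain B where B: "?T - {{\<one>}} = {B}" by (rule card_1_singletonE)
  then have BS: "B \<in> S" "B \<subseteq> H" "B \<noteq> {\<one>}" by blast+
  have "B = H - {\<one>}"
  proof (intro equalityI subsetI)
    fix x assume "x \<in> B"
    then show "x \<in> H - {\<one>}" using BS S_one by blast
  next
    fix x assume x: "x \<in> H - {\<one>}"
    then obtain C where C: "C \<in> S" "x \<in> C" using S_cover Hs(3) by blast
    then have "C \<subseteq> H" "C \<noteq> {\<one>}" using aset_cases[OF Hs(2) C(1)] x by blast+
    then have "C \<in> ?T - {{\<one>}}" using C(1) by blast
    then show "x \<in> B" using B C(2) by simp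
  qed
  then show ?thesis using BS(1) by simp
qed

lemma nontriv_card_bounds:
  assumes H: "nontriv_a_subgroup G S H"
  shows "2 \<le> card {B \<in> S. B \<subseteq> H}" "card {B \<in> S. B \<subseteq> H} < card S"
proof -
  have Ha: "a_subgroup G S H" and ne: "H \<noteq> {\<one>}" "H \<noteq> carrier G"
    using H by (auto simp: nontriv_a_subgroup_def)
  note Hs = a_subgroupD[OF Ha]
  obtain x where x: "x \<in> H" "x \<noteq> \<one>" using ne(1) Hs(5) by blast
  then obtain B where B: "B \<in> S" "x \<in> B" using S_cover Hs(3) by blast
  then have "B \<subseteq> H" using aset_cases[OF Hs(2) B(1)] x(1) by blast
  then have "{{\<one>}, B} \<subseteq> {B \<in> S. B \<subseteq> H}" using B(1) one_S Hs(5) by simp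
  then have "card {{\<one>}, B} \<le> card {B \<in> S. B \<subseteq> H}" using finite_S by (intro card_mono) auto
  moreover have "{\<one>} \<noteq> B" using B(2) x(2) by blast
  ultimately show "2 \<le> card {B \<in> S. B \<subseteq> H}" by simp
  obtain y where y: "y \<in> carrier G" "y \<notin> H" using ne(2) Hs(3) by blast
  then obtain C where "C \<in> S" "y \<in> C" using S_cover by blast
  then have "{B \<in> S. B \<subseteq> H} \<subset> S" using y(2) by blast
  then show "card {B \<in> S. B \<subseteq> H} < card S" using finite_S by (rule psubset_card_mono[rotated])
qed

lemma aset_carrier: "aset (carrier G)"
  by (simp add: aset_iff S_sub)

lemma aset_Diff: "\<lbrakk>aset V; aset W\<rbrakk> \<Longrightarrow> aset (V - W)"
  unfolding aset_iff by blast

lemma nontriv_a_subgroupD: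
  assumes "nontriv_a_subgroup G S H"
  shows "a_subgroup G S H" "H \<noteq> {\<one>}" "H \<noteq> carrier G"
  using assms by (auto simp: nontriv_a_subgroup_def)

lemma rank4_eq:
  assumes S4: "card S = 4"
    and a: "aset A" "aset B" "aset C" "aset D"
    and ne: "A \<noteq> {}" "B \<noteq> {}" "C \<noteq> {}" "D \<noteq> {}"
    and dj: "A \<inter> B = {}" "A \<inter> C = {}" "A \<inter> D = {}" "B \<inter> C = {}" "B \<inter> D = {}" "C \<inter> D = {}"
    and un: "carrier G \<subseteq> A \<union> B \<union> C \<union> D"
  shows "S = {A, B, C, D}"
proof (rule asets_partition_eq)
  have "A \<union> B \<union> C \<union> D \<subseteq> carrier G" by (intro Un_least aset_sub a)
  from this un have "A \<union> B \<union> C \<union> D = carrier G" by (rule equalityI)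
  then have "\<Union>{A, B, C, D} = carrier G" by (simp add: Un_assoc)
  moreover have "disjoint {A, B, C, D}" unfolding disjoint_def using dj by (simp add: Int_commute)
  moreover have "{} \<notin> {A, B, C, D}" using ne by simp
  ultimately show "partition_on (carrier G) {A, B, C, D}"
    unfolding partition_on_def by (intro conjI)
  have "A \<noteq> B" "A \<noteq> C" "A \<noteq> D" "B \<noteq> C" "B \<noteq> D" "C \<noteq> D" using ne dj by blast+
  then show "card {A, B, C, D} = card S" using S4 by simp
qed (use a in auto)

theorem rank4_rank3_subgroup:
  assumes S4: "card S = 4" and H: "nontriv_a_subgroup G S H" and c3: "card {B \<in> S. B \<subseteq> H} = 3"
  shows "(\<exists>L U. nontriv_a_subgroup G S L \<and> nontriv_a_subgroup G S U \<and> L \<subset> U \<and>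
      S = {{\<one>}, L - {\<one>}, U - L, carrier G - U})
   \<or> (\<exists>L p P. nontriv_a_subgroup G S L \<and> Factorial_Ring.prime (p::nat) \<and> p \<ge> 3 \<and> card L = p \<and>
      is_Cyc (G\<lparr>carrier := L\<rparr>) ((p - 1) div 2) P \<and> S = P \<union> {carrier G - L})"
proof -
  let ?T = "{B \<in> S. B \<subseteq> H}"
  note Hn = nontriv_a_subgroupD[OF H]
  note Hs = a_subgroupD[OF Hn(1)]
  obtain h where "cyclic_sring (G\<lparr>carrier := H\<rparr>) ?T h" using sring_restrict[OF Hn(1)] .
  then interpret K: cyclic_sring "G\<lparr>carrier := H\<rparr>" ?T h .
  show ?thesis
  proof (cases "\<exists>N. nontriv_a_subgroup (G\<lparr>carrier := H\<rparr>) ?T N")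
    case True
    then obtain N where N: "nontriv_a_subgroup (G\<lparr>carrier := H\<rparr>) ?T N" by blast
    then have NK: "a_subgroup (G\<lparr>carrier := H\<rparr>) ?T N" "N \<noteq> {\<one>}" "N \<noteq> H"
      by (auto simp: nontriv_a_subgroup_def)
    have Na: "a_subgroup G S N" and NH: "N \<subseteq> H" using a_subgroup_restrict[OF Hn(1) NK(1)] by auto
    note Ns = a_subgroupD[OF Na]
    have sub: "N \<subset> H" using NH NK(3) by blast
    have "nontriv_a_subgroup G S N"
      using Na NK(2) sub Hs(3) by (auto simp: nontriv_a_subgroup_def)
    moreover have "S = {{\<one>}, N - {\<one>}, H - N, carrier G - H}"
    proof (rule rank4_eq[OF S4])
      show "aset {\<one>}" "aset (N - {\<one>})" "aset (H - N)" "aset (carrier G - H)"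
        using aset_basic[OF one_S] aset_Diff Ns(2) Hs(2) aset_carrier by auto
      show "N - {\<one>} \<noteq> {}" using Ns(5) NK(2) by blast
      show "H - N \<noteq> {}" using sub by blast
      show "carrier G - H \<noteq> {}" using Hs(3) Hn(3) by blast
      show "{\<one>} \<inter> (H - N) = {}" "{\<one>} \<inter> (carrier G - H) = {}" using Ns(5) Hs(5) by blast+
      show "(N - {\<one>}) \<inter> (carrier G - H) = {}" using NH by blast
      show "carrier G \<subseteq> {\<one>} \<union> (N - {\<one>}) \<union> (H - N) \<union> (carrier G - H)" by blast
    qed blast+
    ultimately show ?thesis using H sub by (intro disjI1 exI conjI)
  next
    case False
    then have p: "Factorial_Ring.prime (order (G\<lparr>carrier := H\<rparr>))"
      by (intro K.primitive_imp_prime) (use c3 in auto)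
    have oH: "order (G\<lparr>carrier := H\<rparr>) = card H" by (simp add: order_def)
    have cyc2: "is_Cyc (G\<lparr>carrier := H\<rparr>) ((card H - 1) div 2) ?T" and dvd2: "2 dvd card H - 1"
      using K.prime_order_Cyc[OF p] c3 oH by simp_all
    have pH: "Factorial_Ring.prime (card H)" using p oH by simp
    \<comment> \<open>Rank 3 makes 2 a divisor of \<open>card H - 1\<close>, which excludes the
      prime 2.\<close>
    have "card H \<noteq> 2" using dvd2 by auto
    then have "3 \<le> card H" using prime_gt_1_nat[OF pH] by linarith
    moreover have "S = ?T \<union> {carrier G - H}"
    proof (rule asets_partition_eq)
      have T_un: "\<Union>?T = H" using K.part by (simp add: partition_on_def)
      have ne: "carrier G - H \<noteq> {}" using Hs(3) Hn(3) by blast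
      have dj: "disjoint ?T" and "{} \<notin> ?T" using K.part by (simp_all add: partition_on_def)
      have "\<Union>(?T \<union> {carrier G - H}) = carrier G"
        unfolding Union_Un_distrib T_un using Hs(3) by auto
      moreover have "disjoint (?T \<union> {carrier G - H})"
        using dj unfolding disjoint_def by blast
      moreover have "{} \<notin> ?T \<union> {carrier G - H}" using \<open>{} \<notin> ?T\<close> ne by simp
      ultimately show "partition_on (carrier G) (?T \<union> {carrier G - H})"
        unfolding partition_on_def by (intro conjI)
      have "carrier G - H \<notin> ?T" using ne by blast
      then show "card (?T \<union> {carrier G - H}) = card S" using c3 S4 finite_S by simp
    next
      fix T assume "T \<in> ?T \<union> {carrier G - H}"
      then show "aset T" using aset_basic aset_Diff[OF aset_carrier Hs(2)] by blast
    qed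
    ultimately show ?thesis using H pH cyc2 by (intro disjI2 exI conjI) (assumption | rule refl)+
  qed
qed

theorem rank4_two_subgroups:
  assumes S4: "card S = 4"
    and L: "nontriv_a_subgroup G S L" and U: "nontriv_a_subgroup G S U" and ne: "L \<noteq> U"
    and basic: "\<And>H. nontriv_a_subgroup G S H \<Longrightarrow> H - {\<one>} \<in> S"
  shows "L \<inter> U = {\<one>} \<and> L <#> U = carrier G \<and>
      S = {{\<one>}, L - {\<one>}, U - {\<one>}, (L - {\<one>}) <#> (U - {\<one>})}"
proof -
  note Ln = nontriv_a_subgroupD[OF L] and Un = nontriv_a_subgroupD[OF U]
  note Ls = a_subgroupD[OF Ln(1)] and Us = a_subgroupD[OF Un(1)]
  have int: "L \<inter> U = {\<one>}"
  proof (rule ccontr)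
    assume "L \<inter> U \<noteq> {\<one>}"
    then obtain x where "x \<in> L - {\<one>}" "x \<in> U - {\<one>}" using Ls(5) Us(5) by blast
    then have "L - {\<one>} = U - {\<one>}" using S_eq[OF basic[OF L] basic[OF U]] by blast
    then show False using ne Ls(5) Us(5) by blast
  qed
  have LLU: "L \<subseteq> L <#> U"
  proof
    fix x assume x: "x \<in> L"
    then have "x \<otimes> \<one> \<in> L <#> U" using Us(5) unfolding set_mult_def by blast
    then show "x \<in> L <#> U" using x Ls(3) by auto
  qed
  have ULU: "U \<subseteq> L <#> U"
  proof
    fix x assume x: "x \<in> U"
    then have "\<one> \<otimes> x \<in> L <#> U" using Ls(5) unfolding set_mult_def by blast
    then show "x \<in> L <#> U" using x Us(3) by auto
  qed
  \<comment> \<open>If \<open>L <#> U\<close> were proper, its nonidentity part would be a basic set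
    meeting \<open>L - {\<one>}\<close>, hence equal to it, and \<open>U\<close> would lie in
    \<open>L\<close>.\<close>
  have mul: "L <#> U = carrier G"
  proof (rule ccontr)
    assume n: "L <#> U \<noteq> carrier G"
    have "subgroup (L <#> U) G" using mult_subgroups[OF Ls(1) Us(1)] .
    moreover have "aset (L <#> U)" using aset_mult[OF Ls(2) Us(2)] .
    moreover have "L <#> U \<noteq> {\<one>}" using LLU Ln(2) Ls(5) by blast
    ultimately have "nontriv_a_subgroup G S (L <#> U)" using n by (simp add: nontriv_a_subgroup_def a_subgroup_def)
    then have b: "(L <#> U) - {\<one>} \<in> S" by (rule basic)
    obtain x where x: "x \<in> L" "x \<noteq> \<one>" using Ln(2) Ls(5) by blast
    obtain y where y: "y \<in> U" "y \<noteq> \<one>" using Un(2) Us(5) by blast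
    have "L - {\<one>} = (L <#> U) - {\<one>}" using S_eq[OF basic[OF L] b, of x] x LLU by blast
    then have "y \<in> L" using y ULU by blast
    then show False using int y by blast
  qed
  have prod: "z \<in> (L - {\<one>}) <#> (U - {\<one>})" if z: "z \<in> carrier G" "z \<notin> L" "z \<notin> U" for z
  proof -
    have "z \<in> L <#> U" using z(1) mul by simp
    then obtain x y where xy: "x \<in> L" "y \<in> U" "z = x \<otimes> y" unfolding set_mult_def by blast
    have "x \<noteq> \<one>" using xy z(3) Us(3) by auto
    moreover have "y \<noteq> \<one>" using xy z(2) Ls(3) by auto
    ultimately show ?thesis using xy unfolding set_mult_def by blast
  qed
  have notin: "z \<notin> L \<and> z \<notin> U" if z: "z \<in> (L - {\<one>}) <#> (U - {\<one>})" for z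
  proof -
    obtain x y where xy: "x \<in> L" "x \<noteq> \<one>" "y \<in> U" "y \<noteq> \<one>" "z = x \<otimes> y"
      using z unfolding set_mult_def by blast
    have c: "x \<in> carrier G" "y \<in> carrier G" using xy Ls(3) Us(3) by blast+
    have "z \<notin> L"
    proof
      assume "z \<in> L"
      then have "inv x \<otimes> z \<in> L" using subgroup.m_closed[OF Ls(1) subgroup.m_inv_closed[OF Ls(1) xy(1)]] by blast
      then have "y \<in> L" using c xy(5) by (simp add: m_assoc[symmetric])
      then show False using int xy by blast
    qed
    moreover have "z \<notin> U"
    proof
      assume "z \<in> U"
      then have "z \<otimes> inv y \<in> U" using subgroup.m_closed[OF Us(1) _ subgroup.m_inv_closed[OF Us(1) xy(3)]] by blast
      then have "x \<in> U" using c xy(5) by (simp add: m_assoc)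
      then show False using int xy by blast
    qed
    ultimately show ?thesis ..
  qed
  have "S = {{\<one>}, L - {\<one>}, U - {\<one>}, (L - {\<one>}) <#> (U - {\<one>})}"
  proof (rule rank4_eq[OF S4])
    show "aset {\<one>}" "aset (L - {\<one>})" "aset (U - {\<one>})" "aset ((L - {\<one>}) <#> (U - {\<one>}))"
      using aset_basic one_S basic[OF L] basic[OF U] aset_mult by auto
    show "L - {\<one>} \<noteq> {}" "U - {\<one>} \<noteq> {}" using S_ne basic L U by blast+
    then show "(L - {\<one>}) <#> (U - {\<one>}) \<noteq> {}" unfolding set_mult_def by blast
    show "{\<one>} \<inter> ((L - {\<one>}) <#> (U - {\<one>})) = {}" "(L - {\<one>}) \<inter> ((L - {\<one>}) <#> (U - {\<one>})) = {}"
      "(U - {\<one>}) \<inter> ((L - {\<one>}) <#> (U - {\<one>})) = {}" using notin Ls(5) by blast+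
    show "(L - {\<one>}) \<inter> (U - {\<one>}) = {}" using int by blast
    show "carrier G \<subseteq> {\<one>} \<union> (L - {\<one>}) \<union> (U - {\<one>}) \<union> ((L - {\<one>}) <#> (U - {\<one>}))"
      using prod by blast
  qed blast+
  with int mul show ?thesis by (intro conjI)
qed

theorem rank4_wreath_quotient:
  assumes S4: "card S = 4"
    and L: "nontriv_a_subgroup G S L" and uniq: "\<And>H. nontriv_a_subgroup G S H \<Longrightarrow> H = L"
    and L1: "L - {\<one>} \<in> S"
    and WY: "W \<in> S" "Y \<in> S" "W \<noteq> Y" "W \<union> Y = carrier G - L"
    and pure: "\<And>x u. \<lbrakk>x \<in> W; u \<in> L\<rbrakk> \<Longrightarrow> x \<otimes> u \<notin> Y"
  shows "\<exists>p P. nontriv_a_subgroup G S L \<and> Factorial_Ring.prime (p::nat) \<and> p \<ge> 3 \<and> card (rcosets L) = p \<and>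
      is_Cyc (G Mod L) ((p - 1) div 2) P \<and>
      S = {{\<one>}, L - {\<one>}} \<union> {\<Union>Q | Q. Q \<in> P \<and> Q \<noteq> {L}}"
proof -
  note Ln = nontriv_a_subgroupD[OF L]
  note Ls = a_subgroupD[OF Ln(1)]
  have WYc: "W \<subseteq> carrier G" "Y \<subseteq> carrier G" "W \<inter> L = {}" "Y \<inter> L = {}" using WY(4) by blast+
  have disj: "W \<inter> Y = {}" using S_eq[OF WY(1,2)] WY(3) by blast
  have S_eq4: "S = {{\<one>}, L - {\<one>}, W, Y}"
  proof (rule rank4_eq[OF S4])
    show "aset {\<one>}" "aset (L - {\<one>})" "aset W" "aset Y" using aset_basic one_S L1 WY by auto
    show "L - {\<one>} \<noteq> {}" "W \<noteq> {}" "Y \<noteq> {}" using S_ne L1 WY by blast+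
    show "{\<one>} \<inter> W = {}" "{\<one>} \<inter> Y = {}" using WYc(3,4) Ls(5) by blast+
    show "(L - {\<one>}) \<inter> W = {}" "(L - {\<one>}) \<inter> Y = {}" using WYc(3,4) by blast+
    show "W \<inter> Y = {}" using disj .
    show "carrier G \<subseteq> {\<one>} \<union> (L - {\<one>}) \<union> W \<union> Y" using WY(4) by blast
  qed blast+
  have step: "x \<otimes> u \<in> W \<union> Y" if "x \<in> carrier G - L" "u \<in> L" for x u
  proof -
    have "x \<otimes> u \<notin> L"
    proof
      assume "x \<otimes> u \<in> L"
      then have "x \<otimes> u \<otimes> inv u \<in> L"
        using subgroup.m_closed[OF Ls(1) _ subgroup.m_inv_closed[OF Ls(1) that(2)]] by blast
      then show False using that Ls(3) by (simp add: m_assoc subset_iff)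
    qed
    then show ?thesis unfolding WY(4) using that Ls(3) by auto
  qed
  have invW: "x \<otimes> u \<in> W" if "x \<in> W" "u \<in> L" for x u
  proof -
    have "x \<in> carrier G - L" using that(1) WY(4) by blast
    then show ?thesis using step[OF _ that(2)] pure[OF that] by blast
  qed
  \<comment> \<open>Hypothesis \<open>pure\<close> forbids steps from \<open>W\<close> to
    \<open>Y\<close>; a step from \<open>Y\<close> to \<open>W\<close> is reversed by
    \<open>inv u\<close>.\<close>
  have invY: "x \<otimes> u \<in> Y" if "x \<in> Y" "u \<in> L" for x u
  proof (rule ccontr)
    assume n: "x \<otimes> u \<notin> Y"
    have xc: "x \<in> carrier G - L" using that(1) WY(4) by blast
    then have "x \<otimes> u \<in> W" using step[OF _ that(2)] n by blast
    then have "x \<otimes> u \<otimes> inv u \<in> W" using invW subgroup.m_inv_closed[OF Ls(1) that(2)] by blast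
    then have "x \<in> W" using that xc Ls(3) by (simp add: m_assoc subset_iff)
    then show False using that(1) disj by blast
  qed
  have inv: "x \<otimes> l \<in> B" if "B \<in> S" "\<not> B \<subseteq> L" "x \<in> B" "l \<in> L" for B x l
  proof -
    have "B \<in> {{\<one>}, L - {\<one>}, W, Y}" using that(1) by (simp only: S_eq4[symmetric])
    then have "B = W \<or> B = Y" using that(2) Ls(5) by auto
    then show ?thesis using invW invY that(3,4) by blast
  qed
  let ?\<pi> = "\<lambda>x. L #> x"
  let ?Q = "(\<lambda>B. ?\<pi> ` B) ` S"
  have "cyclic_sring (G Mod L) ?Q (?\<pi> g)" by (rule sring_quotient[OF Ln(1) inv])
  then interpret Q: cyclic_sring "G Mod L" ?Q "?\<pi> g" .
  have \<pi>_eq: "?\<pi> x = ?\<pi> y \<longleftrightarrow> (\<exists>l\<in>L. y = x \<otimes> l)" if "x \<in> carrier G" "y \<in> carrier G" for x y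
    using coset_eq_iff[OF Ls(1) that] .
  have \<pi>_L: "?\<pi> x = L" if "x \<in> L" for x using coset_join2[OF _ Ls(1) that] that Ls(3) by blast
  have \<pi>L: "?\<pi> ` B = {L}" if "B \<subseteq> L" "B \<noteq> {}" for B
  proof -
    have "?\<pi> ` B = (\<lambda>x. L) ` B" using that(1) \<pi>_L by (intro image_cong) auto
    then show ?thesis using that(2) by (simp add: image_constant_conv)
  qed
  have Union_\<pi>: "\<Union>(?\<pi> ` B) = B" if B: "B = W \<or> B = Y" for B
  proof (intro equalityI subsetI)
    have Bc: "B \<subseteq> carrier G" using B WYc by blast
    fix y
    {
      assume "y \<in> B"
      then show "y \<in> \<Union>(?\<pi> ` B)" using rcos_self[OF _ Ls(1)] Bc by blast
    next
      assume "y \<in> \<Union>(?\<pi> ` B)"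
      then obtain x where x: "x \<in> B" "y \<in> ?\<pi> x" by blast
      then obtain l where l: "l \<in> L" "y = l \<otimes> x" by (auto simp: r_coset_def)
      then have "y = x \<otimes> l" using x(1) Bc Ls(3) m_comm by blast
      then show "y \<in> B" using B x(1) l(1) invW invY by blast
    }
  qed
  have Wn: "?\<pi> ` W \<noteq> ?\<pi> ` Y" using Union_\<pi>[of W] Union_\<pi>[of Y] WY(3) by metis
  have nL: "?\<pi> ` W \<noteq> {L}" "?\<pi> ` Y \<noteq> {L}"
  proof -
    have "\<Union>{L} = L" by simp
    moreover have "W \<noteq> L" "Y \<noteq> L" using WYc(3,4) Ls(5) by blast+
    ultimately show "?\<pi> ` W \<noteq> {L}" "?\<pi> ` Y \<noteq> {L}"
      using Union_\<pi>[of W] Union_\<pi>[of Y] by (metis (no_types))+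
  qed
  have "L - {\<one>} \<noteq> {}" using S_ne[OF L1] .
  \<comment> \<open>Both \<open>{\<one>}\<close> and \<open>L - {\<one>}\<close> have the image
    \<open>{L}\<close>, so the rank drops from 4 to 3.\<close>
  then have Q_eq: "?Q = {{L}, ?\<pi> ` W, ?\<pi> ` Y}"
    using \<pi>L[of "{\<one>}"] \<pi>L[of "L - {\<one>}"] Ls(5) unfolding S_eq4 by simp
  then have Q3: "card ?Q = 3" using Wn nL by (simp add: eq_commute)
  \<comment> \<open>The preimage of a nontrivial A-subgroup of the quotient is proper and has a
    point \<open>y\<close> outside \<open>L\<close>, against uniqueness.\<close>
  have prim: "\<not> nontriv_a_subgroup (G Mod L) ?Q M" for M
  proof
    assume M: "nontriv_a_subgroup (G Mod L) ?Q M"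
    then have Ma: "a_subgroup (G Mod L) ?Q M" and Mn: "M \<noteq> {L}" "M \<noteq> carrier (G Mod L)"
      by (auto simp: nontriv_a_subgroup_def)
    note Ms = Q.a_subgroupD[OF Ma]
    let ?H = "{x \<in> carrier G. ?\<pi> x \<in> M}"
    have Ha: "a_subgroup G S ?H" by (rule a_subgroup_pullback[OF Ln(1) inv Ma])
    have LM: "L \<in> M" using Ms(5) by simp
    then obtain d where d: "d \<in> M" "d \<noteq> L" using Mn(1) by blast
    then obtain y where y: "y \<in> carrier G" "d = ?\<pi> y" using Ms(3) by (auto simp: carrier_FactGroup)
    then have "y \<in> ?H" "y \<notin> L" using d \<pi>_L by auto
    obtain e where e: "e \<in> carrier (G Mod L)" "e \<notin> M" using Mn(2) Ms(3) by blast
    then obtain z where z: "z \<in> carrier G" "e = ?\<pi> z" by (auto simp: carrier_FactGroup)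
    then have "?H \<noteq> carrier G" using e by blast
    moreover have "?H \<noteq> {\<one>}"
    proof
      assume "?H = {\<one>}"
      with \<open>y \<in> ?H\<close> have "y \<in> {\<one>}" by simp
      then show False using \<open>y \<notin> L\<close> Ls(5) by simp
    qed
    ultimately have "?H = L" using Ha by (intro uniq) (simp add: nontriv_a_subgroup_def)
    then show False using \<open>y \<in> ?H\<close> \<open>y \<notin> L\<close> by simp
  qed
  have o: "order (G Mod L) = card (rcosets L)" by (simp add: order_def FactGroup_def)
  have p: "Factorial_Ring.prime (card (rcosets L))"
    using Q.primitive_imp_prime[OF prim] Q3 o by simp
  have cyc2: "is_Cyc (G Mod L) ((card (rcosets L) - 1) div 2) ?Q" and dvd2: "2 dvd card (rcosets L) - 1"
    using Q.prime_order_Cyc p Q3 unfolding o by simp_all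
  have "card (rcosets L) \<noteq> 2" using dvd2 by auto
  then have "3 \<le> card (rcosets L)" using prime_gt_1_nat[OF p] by linarith
  moreover have "S = {{\<one>}, L - {\<one>}} \<union> {\<Union>C | C. C \<in> ?Q \<and> C \<noteq> {L}}"
  proof -
    have "{\<Union>C | C. C \<in> ?Q \<and> C \<noteq> {L}} = {\<Union>(?\<pi> ` W), \<Union>(?\<pi> ` Y)}"
      unfolding Q_eq using nL by blast
    also have "\<dots> = {W, Y}" using Union_\<pi> by simp
    finally have Q_un: "{\<Union>C | C. C \<in> ?Q \<and> C \<noteq> {L}} = {W, Y}" .
    show ?thesis unfolding Q_un by (rule trans[OF S_eq4]) (simp only: Un_insert_left Un_empty_left)
  qed
  ultimately show ?thesis using L p cyc2 by (intro exI conjI) (assumption | rule refl)+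
qed

end

theorem theorem6p1:
  fixes G :: "('a, 'b) monoid_scheme" and S :: "'a set set"
  assumes "fin_cyclic G" and "is_sring G S" and "card S = 4"
  shows
  "(\<exists>L U. nontriv_a_subgroup G S L \<and> nontriv_a_subgroup G S U \<and>
      L \<inter> U = {\<one>\<^bsub>G\<^esub>} \<and> L <#>\<^bsub>G\<^esub> U = carrier G \<and>
      S = {{\<one>\<^bsub>G\<^esub>}, L - {\<one>\<^bsub>G\<^esub>}, U - {\<one>\<^bsub>G\<^esub>},
           (L - {\<one>\<^bsub>G\<^esub>}) <#>\<^bsub>G\<^esub> (U - {\<one>\<^bsub>G\<^esub>})})
   \<or> (\<exists>L U. nontriv_a_subgroup G S L \<and> nontriv_a_subgroup G S U \<and> L \<subset> U \<and>
      S = {{\<one>\<^bsub>G\<^esub>}, L - {\<one>\<^bsub>G\<^esub>}, U - L, carrier G - U})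
   \<or> (\<exists>L p P. nontriv_a_subgroup G S L \<and> Factorial_Ring.prime (p::nat) \<and> p \<ge> 3 \<and> card L = p \<and>
      is_Cyc (G\<lparr>carrier := L\<rparr>) ((p - 1) div 2) P \<and>
      S = P \<union> {carrier G - L})
   \<or> (\<exists>L p P. nontriv_a_subgroup G S L \<and> Factorial_Ring.prime (p::nat) \<and> p \<ge> 3 \<and> card (rcosets\<^bsub>G\<^esub> L) = p \<and>
      is_Cyc (G Mod L) ((p - 1) div 2) P \<and>
      S = {{\<one>\<^bsub>G\<^esub>}, L - {\<one>\<^bsub>G\<^esub>}} \<union> {\<Union>Q | Q. Q \<in> P \<and> Q \<noteq> {L}})
   \<or> (\<exists>p. Factorial_Ring.prime (p::nat) \<and> card (carrier G) = p \<and> p mod 3 = 1 \<and>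
      is_Cyc G ((p - 1) div 3) S)
   \<or> (card (carrier G) = 4 \<and> S = {{x} | x. x \<in> carrier G})"
  (is "?C1 \<or> ?C2 \<or> ?C3 \<or> ?C4 \<or> ?C5 \<or> ?C6")
proof -
  obtain g where gr: "group G" and fin: "finite (carrier G)" and g: "g \<in> carrier G" "carrier G = generate G {g}"
    using assms(1) unfolding fin_cyclic_def by blast
  interpret G: group G by (rule gr)
  have pow: "\<exists>i::nat. x = g [^]\<^bsub>G\<^esub> i" if "x \<in> carrier G" for x
    using that G.generate_pow_on_finite_carrier[OF fin g(1)] g(2) by blast
  have "comm_group G"
  proof (rule G.group_comm_groupI)
    fix x y assume "x \<in> carrier G" "y \<in> carrier G"
    then obtain i j :: nat where "x = g [^]\<^bsub>G\<^esub> i" "y = g [^]\<^bsub>G\<^esub> j" using pow by blast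
    then show "x \<otimes>\<^bsub>G\<^esub> y = y \<otimes>\<^bsub>G\<^esub> x" using g(1) by (simp add: G.nat_pow_mult add.commute)
  qed
  then interpret cyclic_sring G S g
    using fin g(1) pow assms(2) by (simp add: cyclic_sring_def cyclic_sring_axioms_def)
  consider (primitive) "\<And>H. \<not> nontriv_a_subgroup G S H"
    | (rank3) H where "nontriv_a_subgroup G S H" "card {B \<in> S. B \<subseteq> H} = 3"
    | (rank2) L where "nontriv_a_subgroup G S L" "\<And>H. nontriv_a_subgroup G S H \<Longrightarrow> card {B \<in> S. B \<subseteq> H} \<noteq> 3"
    by blast
  then show ?thesis
  proof cases
    case primitive
    have p: "Factorial_Ring.prime (order G)" using primitive_imp_prime[OF primitive] assms(3) by simp
    \<comment> \<open>Here 3 is \<open>card S - 1\<close>, the number of basic sets other than the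
      identity; it yields both the congruence and the order of the automorphism group.\<close>
    have "3 dvd order G - 1" and c: "is_Cyc G ((order G - 1) div 3) S"
      using prime_order_Cyc[OF p] assms(3) by simp_all
    then obtain k where "order G - 1 = 3 * k" by blast
    then have "order G = 3 * k + 1" using order_pos by linarith
    then have "order G mod 3 = 1" by simp
    then have ?C5 using p c unfolding order_def by (intro exI conjI) (assumption | rule refl)+
    then show ?thesis by - (rule disjI2, rule disjI2, rule disjI2, rule disjI2, rule disjI1)
  next
    case rank3
    from rank4_rank3_subgroup[OF assms(3) rank3] show ?thesis by (elim disjE) (simp_all only: simp_thms)
  next
    case (rank2 L)
    have basic: "H - {\<one>\<^bsub>G\<^esub>} \<in> S" if H: "nontriv_a_subgroup G S H" for H
    proof -
      have "card {B \<in> S. B \<subseteq> H} = 2"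
        using nontriv_card_bounds[OF H] rank2(2)[OF H] assms(3) by linarith
      then show ?thesis using a_subgroup_card_two nontriv_a_subgroupD(1)[OF H] by blast
    qed
    show ?thesis
    proof (cases "\<exists>U. nontriv_a_subgroup G S U \<and> U \<noteq> L")
      case True
      then obtain U where U: "nontriv_a_subgroup G S U" "L \<noteq> U" by blast
      have tensor: "L \<inter> U = {\<one>\<^bsub>G\<^esub>} \<and> L <#>\<^bsub>G\<^esub> U = carrier G \<and>
          S = {{\<one>\<^bsub>G\<^esub>}, L - {\<one>\<^bsub>G\<^esub>}, U - {\<one>\<^bsub>G\<^esub>}, (L - {\<one>\<^bsub>G\<^esub>}) <#>\<^bsub>G\<^esub> (U - {\<one>\<^bsub>G\<^esub>})}"
        by (rule rank4_two_subgroups[OF assms(3) rank2(1) U basic])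
      have ?C1 by (rule exI[of _ L], rule exI[of _ U], rule conjI[OF rank2(1) conjI[OF U(1) tensor]])
      then show ?thesis by (rule disjI1)
    next
      case False
      then have uniq: "\<And>H. nontriv_a_subgroup G S H \<Longrightarrow> H = L" by blast
      note Ls = a_subgroupD[OF nontriv_a_subgroupD(1)[OF rank2(1)]]
      have L1: "L - {\<one>\<^bsub>G\<^esub>} \<in> S" using basic[OF rank2(1)] .
      have "card (S - {{\<one>\<^bsub>G\<^esub>}, L - {\<one>\<^bsub>G\<^esub>}}) = 2"
      proof -
        have "{\<one>\<^bsub>G\<^esub>} \<noteq> L - {\<one>\<^bsub>G\<^esub>}" by blast
        then show ?thesis using one_S L1 assms(3) finite_S by (subst card_Diff_subset) auto
      qed
      then obtain W Y where WYe: "S - {{\<one>\<^bsub>G\<^esub>}, L - {\<one>\<^bsub>G\<^esub>}} = {W, Y}" "W \<noteq> Y"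
        unfolding card_2_iff by (elim exE conjE)
      have WY: "W \<in> S" "Y \<in> S" "W \<noteq> Y" using equalityD2[OF WYe(1)] WYe(2) by simp_all
      have out: "B \<inter> L = {}" if "B \<in> {W, Y}" for B
      proof (rule ccontr)
        have B: "B \<in> S" "B \<noteq> {\<one>\<^bsub>G\<^esub>}" "B \<noteq> L - {\<one>\<^bsub>G\<^esub>}" using that unfolding WYe(1)[symmetric] by simp_all
        assume "B \<inter> L \<noteq> {}"
        then obtain x where x: "x \<in> B" "x \<in> L" by blast
        have "x \<noteq> \<one>\<^bsub>G\<^esub>" using S_one[OF B(1)] B(2) x(1) by metis
        then show False using S_eq[OF B(1) L1 x(1)] x(2) B(3) by simp
      qed
      have un: "W \<union> Y = carrier G - L"
      proof (intro equalityI subsetI)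
        fix x assume "x \<in> W \<union> Y"
        then show "x \<in> carrier G - L" using out[of W] out[of Y] S_sub[OF WY(1)] S_sub[OF WY(2)] by auto
      next
        fix x assume x: "x \<in> carrier G - L"
        then obtain B where B: "B \<in> S" "x \<in> B" using S_cover by blast
        then have "B \<noteq> {\<one>\<^bsub>G\<^esub>}" "B \<noteq> L - {\<one>\<^bsub>G\<^esub>}" using x Ls(5) by auto
        then have "B \<in> {W, Y}" using B(1) unfolding WYe(1)[symmetric] by simp
        then show "x \<in> W \<union> Y" using B by blast
      qed
      show ?thesis
      proof (cases "\<exists>x\<in>W. \<exists>u\<in>L. x \<otimes>\<^bsub>G\<^esub> u \<in> Y")
        case True
        then obtain x u where xu: "x \<in> W" "u \<in> L" "x \<otimes>\<^bsub>G\<^esub> u \<in> Y" by blast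
        have "order G = 4" using mixed_order_four[OF rank2(1) uniq L1 WY un xu] by simp
        then have ?C6 using singletons_of_card assms(3) unfolding order_def by (intro conjI) simp_all
        then show ?thesis by - (rule disjI2, rule disjI2, rule disjI2, rule disjI2, rule disjI2)
      next
        case False
        then have pure: "\<And>x u. \<lbrakk>x \<in> W; u \<in> L\<rbrakk> \<Longrightarrow> x \<otimes>\<^bsub>G\<^esub> u \<notin> Y" by blast
        have ?C4 by (rule exI[of _ L], rule rank4_wreath_quotient[OF assms(3) rank2(1) uniq L1 WY un pure])
        then show ?thesis by - (rule disjI2, rule disjI2, rule disjI2, rule disjI1)
      qed
    qed
  qed
qed

end
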